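(* There is an absolute constant $C>0$ such that the following holds. Let $p$ be a positive even integer, let $k\ge p$ be an integer, let $0<\varepsilon<1$, and let $X$ be a $k$-dimensional subspace of $L_p$. Then $X$ $(1+\varepsilon)$-embeds in $\ell_p^n$ for every positive integer $n\ge C\,\varepsilon^{-2}\left(\frac{10k}{p}\right)^{p/2}$ (that is, $X$ $(1+\varepsilon)$-embeds in $\ell_p^n$ for $n=O\big(\varepsilon^{-2}(\tfrac{10k}{p})^{p/2}\big)$). Equivalently, there is a universal constant $c>0$ such that for every positive even integer $p$, every $0<\varepsilon<1$, every positive integer $n$ and every integer $k$ with $p\le k\le c\,\varepsilon^{4/p}\,p\,n^{2/p}$, any $k$-dimensional subspace of $L_p$ $(1+\varepsilon)$-embeds in $\ell_p^n$.
   Context: All spaces are over the real numbers. $L_p=L_p[0,1]$ (Lebesgue measure) with its usual norm, and $\ell_p^n$ is $\mathbb{R}^n$ with the norm $\|x\|_p=(\sum_{i=1}^n|x(i)|^p)^{1/p}$. A normed space $X$ is said to $(1+\varepsilon)$-embed in $\ell_p^n$ if there is a linear map $T:X\to\ell_p^n$ with $\|x\|\le\|Tx\|_p\le(1+\varepsilon)\|x\|$ for all $x\in X$. The constants $C$ and $c$ do not depend on $p,k,n,\varepsilon$ or $X$. *)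

theory Defs
  imports "HOL-Analysis.Analysis"
begin

text \<open>
  Since \<^term>\<open>p\<close> varies, the spaces $L_p[0,1]$ are subsets of one type of real vectors: the
  Lebesgue measurable functions on $[0,1]$ modulo equality almost everywhere.
\<close>

abbreviation leb01 :: "real measure" where
  "leb01 \<equiv> lebesgue_on {0..1}"

definition ae_eq01 :: "(real \<Rightarrow> real) \<Rightarrow> (real \<Rightarrow> real) \<Rightarrow> bool" where
  "ae_eq01 f g \<longleftrightarrow>
     f \<in> borel_measurable leb01 \<and> g \<in> borel_measurable leb01 \<and> (AE t in leb01. f t = g t)"

lemma part_equivp_ae_eq01: "part_equivp ae_eq01"
proof (rule part_equivpI)
  show "\<exists>f. ae_eq01 f f"
    by (rule exI[of _ "\<lambda>_. 0"]) (simp add: ae_eq01_def)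
  show "symp ae_eq01"
    by (rule sympI) (auto simp: ae_eq01_def elim: AE_mp)
  show "transp ae_eq01"
  proof (rule transpI)
    fix f g h assume "ae_eq01 f g" "ae_eq01 g h"
    then show "ae_eq01 f h"
      unfolding ae_eq01_def by (auto elim!: eventually_elim2)
  qed
qed

quotient_type l0 = "real \<Rightarrow> real" / partial: ae_eq01
  by (rule part_equivp_ae_eq01)

instantiation l0 :: real_vector
begin

lift_definition zero_l0 :: l0 is "\<lambda>_. 0"
  by (simp add: ae_eq01_def)

lift_definition plus_l0 :: "l0 \<Rightarrow> l0 \<Rightarrow> l0" is "\<lambda>f g t. f t + g t"
  unfolding ae_eq01_def by (auto elim!: eventually_elim2)

lift_definition minus_l0 :: "l0 \<Rightarrow> l0 \<Rightarrow> l0" is "\<lambda>f g t. f t - g t"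
  unfolding ae_eq01_def by (auto elim!: eventually_elim2)

lift_definition uminus_l0 :: "l0 \<Rightarrow> l0" is "\<lambda>f t. - f t"
  unfolding ae_eq01_def by (auto elim!: eventually_mono)

lift_definition scaleR_l0 :: "real \<Rightarrow> l0 \<Rightarrow> l0" is "\<lambda>c f t. c * f t"
  unfolding ae_eq01_def by (auto elim!: eventually_mono)

instance
  by standard (transfer; auto simp: ae_eq01_def algebra_simps)+

end

lift_definition in_Lp :: "real \<Rightarrow> l0 \<Rightarrow> bool"
  is "\<lambda>p f. integrable leb01 (\<lambda>t. \<bar>f t\<bar> powr p)"
  unfolding ae_eq01_def by (intro integrable_cong_AE) (auto elim!: eventually_mono)

definition Lp :: "real \<Rightarrow> l0 set" where
  "Lp p = {f. in_Lp p f}"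

lift_definition Lp_norm :: "real \<Rightarrow> l0 \<Rightarrow> real"
  is "\<lambda>p f. (integral\<^sup>L leb01 (\<lambda>t. \<bar>f t\<bar> powr p)) powr (1 / p)"
  unfolding ae_eq01_def
  by (intro arg_cong[where f = "\<lambda>x. x powr _"] integral_cong_AE) (auto elim!: eventually_mono)

text \<open>
  The carrier of $\ell_p^n$: vectors of $\mathbb{R}^n$ are indexed by \<^term>\<open>{..<n}\<close> and
  padded with zeros.
\<close>

definition Rn :: "nat \<Rightarrow> (nat \<Rightarrow> real) set" where
  "Rn n = {v. \<forall>i\<ge>n. v i = 0}"

definition lp_norm :: "real \<Rightarrow> nat \<Rightarrow> (nat \<Rightarrow> real) \<Rightarrow> real" where
  "lp_norm p n v = (\<Sum>i<n. \<bar>v i\<bar> powr p) powr (1 / p)"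

text \<open>
  The normed space is the subspace \<^term>\<open>X\<close> with norm \<^term>\<open>N\<close>; the values of
  \<^term>\<open>T\<close> outside \<^term>\<open>X\<close> are irrelevant.
\<close>

definition embeds_lp ::
    "'a::real_vector set \<Rightarrow> ('a \<Rightarrow> real) \<Rightarrow> real \<Rightarrow> real \<Rightarrow> nat \<Rightarrow> bool" where
  "embeds_lp X N \<epsilon> p n \<longleftrightarrow>
     (\<exists>T. T \<in> X \<rightarrow> Rn n \<and>
          (\<forall>x\<in>X. \<forall>y\<in>X. \<forall>i. T (x + y) i = T x i + T y i) \<and>
          (\<forall>c. \<forall>x\<in>X. \<forall>i. T (c *\<^sub>R x) i = c * T x i) \<and>
          (\<forall>x\<in>X. N x \<le> lp_norm p n (T x) \<and> lp_norm p n (T x) \<le> (1 + \<epsilon>) * N x))"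

end

theory Submission
  imports "Jordan_Normal_Form.Determinant" Defs
begin

text \<open>
  Write \<open>p = 2 q\<close>. The powers \<open>x\<^sup>q\<close>, \<open>x \<in> X\<close>, lie in the span of the monomials of degree \<open>q\<close> in a basis
  of \<open>X\<close>, a subspace of $L_2$ of dimension \<open>m \<le> (k + q - 1 choose q) \<le> (10 k / p)\<^sup>q\<close>. It suffices
  to discretise the $L_2$ norm on this span with \<open>n = O(m / \<epsilon>\<^sup>2)\<close> weighted points, because
  \<open>\<parallel>x\<parallel>\<^sub>p\<^sup>p\<close> is the square of the $L_2$ norm of \<open>x\<^sup>q\<close>.

  The discretisation is the barrier argument of Batson, Spielman and Srivastava, with the sum of
  rank one matrices replaced by an integral. For an orthonormal basis \<open>v\<close> of the span, weighted matrices
  \<open>s v(t) v(t)\<^sup>T\<close> are added one at a time to \<open>A\<close>, while an upper barrier \<open>u\<close> moves by \<open>d\<close> and a lower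
  barrier \<open>l\<close> by \<open>1\<close>; the traces of \<open>(u I - A)\<^sup>-\<^sup>1\<close> and \<open>(A - l I)\<^sup>-\<^sup>1\<close> never exceed \<open>\<eta>\<close>. A suitable
  point \<open>t\<close> exists in each step since the admissible values of \<open>1 / s\<close> form an interval
  whose endpoints are linear in \<open>v(t) v(t)\<^sup>T\<close> and whose mean length is positive.
\<close>

unbundle no vec_syntax
unbundle no inner_syntax
hide_const (open) Finite_Cartesian_Product.vec Determinants.det trace Finite_Cartesian_Product.mat

section \<open>Traces of positive definite matrices\<close>

declare minus_carrier_mat [simp]

definition tr :: "real mat \<Rightarrow> real" where
  "tr A = (\<Sum>i<dim_row A. A $$ (i, i))"

lemma tr_add: "A \<in> carrier_mat n n \<Longrightarrow> B \<in> carrier_mat n n \<Longrightarrow> tr (A + B) = tr A + tr B"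
  by (auto simp: tr_def sum.distrib)

lemma tr_diff: "A \<in> carrier_mat n n \<Longrightarrow> B \<in> carrier_mat n n \<Longrightarrow> tr (A - B) = tr A - tr B"
  by (auto simp: tr_def sum_subtractf)

lemma tr_smult: "A \<in> carrier_mat n n \<Longrightarrow> tr (c \<cdot>\<^sub>m A) = c * tr A"
  by (auto simp: tr_def sum_distrib_left)

lemma tr_mult:
  assumes "A \<in> carrier_mat n n" "B \<in> carrier_mat n n"
  shows "tr (A * B) = (\<Sum>i<n. \<Sum>j<n. A $$ (i, j) * B $$ (j, i))"
  using assms by (simp add: tr_def scalar_prod_def atLeast0LessThan)

lemma tr_mult_comm:
  assumes "A \<in> carrier_mat n n" "B \<in> carrier_mat n n"
  shows "tr (A * B) = tr (B * A)"
  unfolding tr_mult[OF assms] tr_mult[OF assms(2,1)]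
  by (subst sum.swap) (simp add: mult.commute)

definition spd :: "nat \<Rightarrow> real mat \<Rightarrow> bool" where
  "spd n A \<longleftrightarrow> A \<in> carrier_mat n n \<and> transpose_mat A = A \<and>
     (\<forall>x\<in>carrier_vec n. x \<noteq> 0\<^sub>v n \<longrightarrow> 0 < x \<bullet> (A *\<^sub>v x))"

lemma spd_carrier: "spd n A \<Longrightarrow> A \<in> carrier_mat n n"
  and spd_sym: "spd n A \<Longrightarrow> transpose_mat A = A"
  and spd_pos: "spd n A \<Longrightarrow> x \<in> carrier_vec n \<Longrightarrow> x \<noteq> 0\<^sub>v n \<Longrightarrow> 0 < x \<bullet> (A *\<^sub>v x)"
  by (auto simp: spd_def)

lemma square_mult_carrier [simp]:
  "A \<in> carrier_mat n n \<Longrightarrow> B \<in> carrier_mat n n \<Longrightarrow> A * B \<in> carrier_mat n n"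
  by simp

lemma spd_nonneg:
  assumes "spd n A" "x \<in> carrier_vec n"
  shows "0 \<le> x \<bullet> (A *\<^sub>v x)"
  using spd_pos[OF assms] spd_carrier[OF assms(1)] assms(2)
  by (cases "x = 0\<^sub>v n") auto

lemma spd_inner_comm:
  assumes "spd n A" "x \<in> carrier_vec n" "y \<in> carrier_vec n"
  shows "x \<bullet> (A *\<^sub>v y) = y \<bullet> (A *\<^sub>v x)"
proof -
  have "x \<bullet> (A *\<^sub>v y) = (A *\<^sub>v x) \<bullet> y"
    using transpose_vec_mult_scalar[OF spd_carrier[OF assms(1)] assms(3,2)] spd_sym[OF assms(1)]
    by simp
  also have "\<dots> = y \<bullet> (A *\<^sub>v x)"
    using comm_scalar_prod[of "A *\<^sub>v x" n y] assms spd_carrier[OF assms(1)] by simp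
  finally show ?thesis .
qed

text \<open>A positive definite matrix has trivial kernel, so its determinant is nonzero. The
  inverse \<open>B\<close> is symmetric because its transpose is also an inverse of
  \<open>A\<close>. It is positive because \<open>x = A y\<close> turns the form of \<open>B\<close>
  at \<open>x\<close> into the form of \<open>A\<close> at \<open>y\<close>.\<close>

lemma spd_inverse:
  assumes A: "spd n A"
  obtains B where "spd n B" "A * B = 1\<^sub>m n" "B * A = 1\<^sub>m n"
proof -
  note cA = spd_carrier[OF A]
  have "det A \<noteq> 0"
  proof
    assume "det A = 0"
    then obtain v where "v \<in> carrier_vec n" "v \<noteq> 0\<^sub>v n" "A *\<^sub>v v = 0\<^sub>v n"
      using det_0_iff_vec_prod_zero_field[OF cA] by auto
    then show False using spd_pos[OF A, of v] by simp
  qed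
  from det_non_zero_imp_unit[OF cA this, unfolded Units_def, of "()"]
  obtain B where B: "B \<in> carrier_mat n n" "B * A = 1\<^sub>m n" "A * B = 1\<^sub>m n"
    by (auto simp: ring_mat_def)
  have tB: "transpose_mat B * A = 1\<^sub>m n"
    using transpose_mult[OF cA B(1)] B spd_sym[OF A] by simp
  have "transpose_mat B = transpose_mat B * (A * B)" using B by simp
  also have "\<dots> = (transpose_mat B * A) * B"
    using assoc_mult_mat[of "transpose_mat B" n n A n B n] B(1) cA by simp
  also have "\<dots> = B" using tB B(1) by simp
  finally have symB: "transpose_mat B = B" .
  have "0 < x \<bullet> (B *\<^sub>v x)" if x: "x \<in> carrier_vec n" "x \<noteq> 0\<^sub>v n" for x
  proof -
    let ?y = "B *\<^sub>v x"
    have y: "?y \<in> carrier_vec n" using B x by simp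
    have Ay: "A *\<^sub>v ?y = x"
      using assoc_mult_mat_vec[OF cA B(1) x(1)] B x by simp
    have "A *\<^sub>v 0\<^sub>v n = 0\<^sub>v n" using cA by auto
    then have "?y \<noteq> 0\<^sub>v n" using x Ay by metis
    from spd_pos[OF A y this] have "0 < ?y \<bullet> x" by (simp add: Ay)
    then show ?thesis using comm_scalar_prod[OF x(1) y] by simp
  qed
  then have "spd n B" using B symB by (simp add: spd_def)
  with B that show thesis by blast
qed

lemma spd_diag_pos:
  assumes A: "spd n A" and i: "i < n"
  shows "0 < A $$ (i, i)"
proof -
  have "unit_vec n i \<noteq> (0\<^sub>v n :: real Matrix.vec)"
    using i by (metis index_unit_vec(2) index_zero_vec(1) one_neq_zero)
  then have "0 < unit_vec n i \<bullet> (A *\<^sub>v unit_vec n i)"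
    by (intro spd_pos[OF A]) auto
  then show ?thesis using spd_carrier[OF A] i by simp
qed

lemma tr_spd_pos: "spd n A \<Longrightarrow> 0 < n \<Longrightarrow> 0 < tr A"
  unfolding tr_def using spd_carrier[of n A]
  by (intro sum_pos) (auto intro: spd_diag_pos)

text \<open>The trace is the sum of the values of the form of \<open>B\<close> at the columns of
  \<open>X\<close>.\<close>

lemma tr_conj_nonneg:
  assumes B: "spd n B" and X: "X \<in> carrier_mat n n"
  shows "0 \<le> tr (transpose_mat X * (B * X))"
proof -
  note cB = spd_carrier[OF B]
  have "tr (transpose_mat X * (B * X)) = (\<Sum>i<n. col X i \<bullet> (B *\<^sub>v col X i))"
    using X cB by (simp add: tr_def col_mult2[symmetric] del: col_mult2)
  also have "\<dots> \<ge> 0" using X by (intro sum_nonneg spd_nonneg[OF B]) auto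
  finally show ?thesis .
qed


text \<open>By symmetry the trace is the squared Frobenius norm of \<open>P\<close>, which dominates
  the square of one positive diagonal entry.\<close>

lemma tr_square_pos:
  assumes P: "spd n P" and n: "0 < n"
  shows "0 < tr (P * P)"
proof -
  note cP = spd_carrier[OF P]
  have sym: "P $$ (j, i) = P $$ (i, j)" if "i < n" "j < n" for i j
    using spd_sym[OF P] cP that by (metis carrier_matD index_transpose_mat(1))
  have "0 < (P $$ (0, 0))\<^sup>2" using spd_diag_pos[OF P n] by simp
  also have "\<dots> \<le> (\<Sum>j<n. (P $$ (0, j))\<^sup>2)"
    using n by (intro member_le_sum) auto
  also have "\<dots> \<le> (\<Sum>i<n. \<Sum>j<n. (P $$ (i, j))\<^sup>2)"
    using n by (intro member_le_sum[where f = "\<lambda>i. \<Sum>j<n. (P $$ (i, j))\<^sup>2"]) (auto intro: sum_nonneg)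
  also have "\<dots> = tr (P * P)"
    unfolding tr_mult[OF cP cP] by (intro sum.cong) (auto simp: sym power2_eq_square)
  finally show ?thesis .
qed

lemma tr_conj_spd_nonneg:
  assumes "spd n B" "spd n P"
  shows "0 \<le> tr (P * (B * P))"
  using tr_conj_nonneg[OF assms(1) spd_carrier[OF assms(2)]] spd_sym[OF assms(2)] by simp

text \<open>This is the Cauchy-Schwarz inequality for the inner product tr (X^T B Y), applied to
  \<open>P\<close> and the identity matrix.\<close>

lemma tr_cauchy_schwarz:
  assumes B: "spd n B" and P: "spd n P" and n: "0 < n"
  shows "(tr (P * B))\<^sup>2 \<le> tr (P * (B * P)) * tr B"
proof -
  note [simp] = spd_carrier[OF B] spd_carrier[OF P]
  \<comment> \<open>This value of \<open>t\<close> minimises the nonnegative quadratic polynomial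
    obtained from \<open>P - t I\<close> in that inner product.\<close>
  define t where "t = tr (P * B) / tr B"
  have trB: "0 < tr B" by (rule tr_spd_pos[OF B n])
  let ?X = "P - t \<cdot>\<^sub>m 1\<^sub>m n"
  have X: "?X \<in> carrier_mat n n" by simp
  have "transpose_mat ?X = ?X"
    using transpose_minus[of P n n "t \<cdot>\<^sub>m 1\<^sub>m n"] spd_sym[OF P]
    by (auto intro!: eq_matI)
  then have "0 \<le> tr (?X * (B * ?X))"
    using tr_conj_nonneg[OF B X] by simp
  also have "B * ?X = B * P - t \<cdot>\<^sub>m B"
    using mult_minus_distrib_mat[of B n n P n "t \<cdot>\<^sub>m 1\<^sub>m n"]
      mult_smult_distrib[of B n n "1\<^sub>m n" n t] right_mult_one_mat[OF spd_carrier[OF B]] by simp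
  also have "?X * (B * P - t \<cdot>\<^sub>m B) = (P * (B * P) - t \<cdot>\<^sub>m (P * B)) - (t \<cdot>\<^sub>m (B * P) - (t * t) \<cdot>\<^sub>m B)"
    using minus_mult_distrib_mat[of P n n "t \<cdot>\<^sub>m 1\<^sub>m n" "B * P - t \<cdot>\<^sub>m B" n]
      mult_minus_distrib_mat[of P n n "B * P" n "t \<cdot>\<^sub>m B"]
      mult_smult_distrib[of P n n B n t]
      mult_smult_assoc_mat[of "1\<^sub>m n" n n "B * P - t \<cdot>\<^sub>m B" n t]
      left_mult_one_mat[of "B * P - t \<cdot>\<^sub>m B" n n] carrier_matD[OF spd_carrier[OF B]]
      carrier_matD[OF spd_carrier[OF P]]
    by (auto intro!: eq_matI simp: algebra_simps)
  also have "tr \<dots> = tr (P * (B * P)) - 2 * t * tr (P * B) + t * t * tr B"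
    by (simp add: tr_diff[of _ n] tr_smult[of _ n] tr_mult_comm[of B n P])
  also have "\<dots> = tr (P * (B * P)) - (tr (P * B))\<^sup>2 / tr B"
    using trB by (simp add: t_def power2_eq_square field_simps)
  finally show ?thesis using trB by (simp add: field_simps)
qed

lemma transpose_smult_mat: "transpose_mat (c \<cdot>\<^sub>m A) = c \<cdot>\<^sub>m transpose_mat A"
  by (auto intro!: eq_matI)

lemma smult_mat_mult_vec:
  fixes A :: "real mat"
  assumes "A \<in> carrier_mat n m" "x \<in> carrier_vec m"
  shows "(c \<cdot>\<^sub>m A) *\<^sub>v x = c \<cdot>\<^sub>v (A *\<^sub>v x)"
  using assms by (auto intro!: eq_vecI simp: scalar_prod_def sum_distrib_left mult.assoc)

lemma scalar_prod_self_pos: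
  fixes x :: "real Matrix.vec"
  assumes "x \<in> carrier_vec n" "x \<noteq> 0\<^sub>v n"
  shows "0 < x \<bullet> x"
proof -
  obtain i where "i < n" "x $ i \<noteq> 0"
    using assms by (metis carrier_vecD eq_vecI index_zero_vec)
  then show ?thesis
    using assms(1) unfolding scalar_prod_def by (intro sum_pos2[of _ i]) (auto simp: less_le)
qed

section \<open>Resolvents under a shift by a multiple of the identity\<close>

lemma resolvent_identity:
  fixes M P P' :: "real mat"
  assumes M: "M \<in> carrier_mat n n" and P: "P \<in> carrier_mat n n" "P * M = 1\<^sub>m n"
    and P': "P' \<in> carrier_mat n n" "(M + d \<cdot>\<^sub>m 1\<^sub>m n) * P' = 1\<^sub>m n"
  shows "P = P' + d \<cdot>\<^sub>m (P * P')"
proof -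
  have "P = P * ((M + d \<cdot>\<^sub>m 1\<^sub>m n) * P')" by (simp only: P' right_mult_one_mat[OF P(1)])
  also have "\<dots> = (P * (M + d \<cdot>\<^sub>m 1\<^sub>m n)) * P'"
    using M P P' by (intro assoc_mult_mat[symmetric]) auto
  also have "P * (M + d \<cdot>\<^sub>m 1\<^sub>m n) = 1\<^sub>m n + d \<cdot>\<^sub>m P"
    using mult_add_distrib_mat[of P n n M n "d \<cdot>\<^sub>m 1\<^sub>m n"] mult_smult_distrib[of P n n "1\<^sub>m n" n d] M P
    by simp
  also have "(1\<^sub>m n + d \<cdot>\<^sub>m P) * P' = P' + d \<cdot>\<^sub>m (P * P')"
    using add_mult_distrib_mat[of "1\<^sub>m n" n n "d \<cdot>\<^sub>m P" P' n] mult_smult_assoc_mat[of P n n P' n d] P P'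
    by simp
  finally show ?thesis .
qed

text \<open>The three formulas are traces of the resolvent identity P = P' + d P P': as it stands,
  multiplied by P' on the right, and multiplied by P on the left. Cyclic rearrangement brings the
  last terms of the second and third into the form of a conjugation, so that
  \<open>tr_conj_spd_nonneg\<close> gives their sign.\<close>

lemma resolvent_traces:
  assumes M: "M \<in> carrier_mat n n" and P: "spd n P" "P * M = 1\<^sub>m n"
    and P': "spd n P'" "(M + d \<cdot>\<^sub>m 1\<^sub>m n) * P' = 1\<^sub>m n"
  shows "tr P = tr P' + d * tr (P * P')"
    and "tr (P * P') = tr (P' * P') + d * tr (P' * (P * P'))"
    and "tr (P * P) = tr (P * P') + d * tr (P * (P' * P))"
proof -
  note cP [simp] = spd_carrier[OF P(1)] and cP' [simp] = spd_carrier[OF P'(1)]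
  note carriers = cP cP' square_mult_carrier smult_carrier_mat
  have eq: "P = P' + d \<cdot>\<^sub>m (P * P')"
    using assms by (intro resolvent_identity) auto
  show "tr P = tr P' + d * tr (P * P')"
    using arg_cong[OF eq, of tr] by (simp only: tr_add[of _ n] tr_smult[of _ n] carriers)
  have eq1: "P * P' = P' * P' + d \<cdot>\<^sub>m (P * (P' * P'))"
    using add_mult_distrib_mat[of P' n n "d \<cdot>\<^sub>m (P * P')" P' n]
      mult_smult_assoc_mat[of "P * P'" n n P' n d] assoc_mult_mat[OF cP cP' cP'] eq by simp
  have "tr (P * P') = tr (P' * P') + d * tr (P * (P' * P'))"
    using arg_cong[OF eq1, of tr] by (simp only: tr_add[of _ n] tr_smult[of _ n] carriers)
  also have "tr (P * (P' * P')) = tr ((P * P') * P')"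
    by (simp only: assoc_mult_mat[OF cP cP' cP'])
  also have "\<dots> = tr (P' * (P * P'))"
    by (rule tr_mult_comm[where n = n]) simp_all
  finally show "tr (P * P') = tr (P' * P') + d * tr (P' * (P * P'))" .
  have eq2: "P * P = P * P' + d \<cdot>\<^sub>m (P * (P * P'))"
    using mult_add_distrib_mat[of P n n P' n "d \<cdot>\<^sub>m (P * P')"]
      mult_smult_distrib[of P n n "P * P'" n d] eq by simp
  have "tr (P * P) = tr (P * P') + d * tr (P * (P * P'))"
    using arg_cong[OF eq2, of tr] by (simp only: tr_add[of _ n] tr_smult[of _ n] carriers)
  also have "tr (P * (P * P')) = tr ((P * P') * P)"
    by (rule tr_mult_comm[where n = n]) simp_all
  also have "\<dots> = tr (P * (P' * P))" by (simp only: assoc_mult_mat[OF cP cP' cP])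
  finally show "tr (P * P) = tr (P * P') + d * tr (P * (P' * P))" .
qed

section \<open>Rank one matrices and rank one perturbations\<close>

definition rank1 :: "nat \<Rightarrow> (nat \<Rightarrow> real) \<Rightarrow> real mat" where
  "rank1 n x = mat n n (\<lambda>(i, j). x i * x j)"

lemma rank1_carrier [simp]: "rank1 n x \<in> carrier_mat n n"
  by (simp add: rank1_def)

lemma transpose_rank1 [simp]: "transpose_mat (rank1 n x) = rank1 n x"
  by (auto simp: rank1_def intro!: eq_matI)

lemma tr_mult_rank1:
  assumes "B \<in> carrier_mat n n"
  shows "tr (B * rank1 n x) = (\<Sum>i<n. \<Sum>j<n. B $$ (i, j) * (x j * x i))"
  unfolding tr_mult[OF assms rank1_carrier] by (intro sum.cong) (auto simp: rank1_def)

text \<open>The scalar x^T B x sits in the middle of the product. It is written as a trace, as are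
  all quadratic forms in the sampled vectors, because traces against \<open>rank1\<close> can be
  integrated over the points (\<open>integral_tr_rank1\<close>).\<close>

lemma rank1_sandwich:
  assumes "B \<in> carrier_mat n n"
  shows "rank1 n x * (B * rank1 n x) = tr (B * rank1 n x) \<cdot>\<^sub>m rank1 n x"
  using assms unfolding tr_mult_rank1[OF assms]
  by (auto intro!: eq_matI simp: rank1_def scalar_prod_def atLeast0LessThan sum_distrib_left sum_distrib_right
        intro!: sum.cong)

lemma rank1_quadratic_form:
  assumes "B \<in> carrier_mat n n"
  shows "vec n x \<bullet> (B *\<^sub>v vec n x) = tr (B * rank1 n x)"
  unfolding tr_mult_rank1[OF assms] using assms
  by (auto simp: scalar_prod_def atLeast0LessThan sum_distrib_left intro!: sum.cong)

lemma quadratic_form_rank1: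
  assumes "y \<in> carrier_vec n"
  shows "y \<bullet> (rank1 n x *\<^sub>v y) = (vec n x \<bullet> y)\<^sup>2"
  using assms
  by (auto simp: rank1_def scalar_prod_def atLeast0LessThan sum_distrib_left sum_distrib_right
        power2_eq_square algebra_simps intro!: sum.cong)

lemma quadratic_form_add_rank1:
  assumes M: "M \<in> carrier_mat n n" and x: "x \<in> carrier_vec n"
  shows "x \<bullet> ((M + s \<cdot>\<^sub>m rank1 n v) *\<^sub>v x) = x \<bullet> (M *\<^sub>v x) + s * (vec n v \<bullet> x)\<^sup>2"
proof -
  have "(M + s \<cdot>\<^sub>m rank1 n v) *\<^sub>v x = M *\<^sub>v x + s \<cdot>\<^sub>v (rank1 n v *\<^sub>v x)"
    using add_mult_distrib_mat_vec[OF M _ x, of "s \<cdot>\<^sub>m rank1 n v"]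
      smult_mat_mult_vec[OF rank1_carrier x] by simp
  then show ?thesis
    using scalar_prod_add_distrib[OF x, of "M *\<^sub>v x" "s \<cdot>\<^sub>v (rank1 n v *\<^sub>v x)"]
      mult_mat_vec_carrier[OF M x] mult_mat_vec_carrier[OF rank1_carrier x, of v] x
    by (simp add: quadratic_form_rank1)
qed

text \<open>The Fenchel inequality between the forms of \<open>M\<close> and of its inverse: expand
  the nonnegative form of \<open>M\<close> at \<open>x - y\<close>, where \<open>y = P v\<close>
  solves \<open>M y = v\<close>.\<close>

lemma spd_fenchel:
  assumes M: "spd n M" and P: "P \<in> carrier_mat n n" "M * P = 1\<^sub>m n"
    and v: "v \<in> carrier_vec n" and x: "x \<in> carrier_vec n"
  shows "2 * (v \<bullet> x) - v \<bullet> (P *\<^sub>v v) \<le> x \<bullet> (M *\<^sub>v x)"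
proof -
  note cM = spd_carrier[OF M]
  define y where "y = P *\<^sub>v v"
  have y: "y \<in> carrier_vec n" using P v by (simp add: y_def)
  have My: "M *\<^sub>v y = v"
    using assoc_mult_mat_vec[OF cM P(1) v] P v by (simp add: y_def)
  have Mx: "M *\<^sub>v x \<in> carrier_vec n" using cM x by simp
  have "0 \<le> (x - y) \<bullet> (M *\<^sub>v (x - y))" using x y by (intro spd_nonneg[OF M]) auto
  also have "M *\<^sub>v (x - y) = M *\<^sub>v x - v"
    using mult_minus_distrib_mat_vec[OF cM x y] My by simp
  also have "(x - y) \<bullet> (M *\<^sub>v x - v) = x \<bullet> (M *\<^sub>v x) - x \<bullet> v - (y \<bullet> (M *\<^sub>v x) - y \<bullet> v)"
    using minus_scalar_prod_distrib[of x n y "M *\<^sub>v x - v"]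
      scalar_prod_minus_distrib[of x n "M *\<^sub>v x" v] scalar_prod_minus_distrib[of y n "M *\<^sub>v x" v]
      x y v Mx by simp
  also have "y \<bullet> (M *\<^sub>v x) = x \<bullet> v"
    using spd_inner_comm[OF M y x] My by simp
  finally show ?thesis
    using comm_scalar_prod[OF x v] comm_scalar_prod[OF y v] by (simp add: y_def)
qed

lemma spd_add_rank1:
  assumes M: "spd n M" and "0 \<le> s"
  shows "spd n (M + s \<cdot>\<^sub>m rank1 n v)"
  unfolding spd_def
proof (intro conjI ballI impI)
  note cM = spd_carrier[OF M]
  show "M + s \<cdot>\<^sub>m rank1 n v \<in> carrier_mat n n" by simp
  show "transpose_mat (M + s \<cdot>\<^sub>m rank1 n v) = M + s \<cdot>\<^sub>m rank1 n v"
    using transpose_add[OF cM, of "s \<cdot>\<^sub>m rank1 n v"] spd_sym[OF M] by (simp add: transpose_smult_mat)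
  fix x :: "real Matrix.vec" assume x: "x \<in> carrier_vec n" "x \<noteq> 0\<^sub>v n"
  then show "0 < x \<bullet> ((M + s \<cdot>\<^sub>m rank1 n v) *\<^sub>v x)"
    using spd_pos[OF M x] \<open>0 \<le> s\<close> by (simp add: quadratic_form_add_rank1[OF cM] add_pos_nonneg)
qed

lemma spd_diff_rank1:
  assumes M: "spd n M" and P: "P \<in> carrier_mat n n" "M * P = 1\<^sub>m n"
    and s: "0 \<le> s" "s * tr (P * rank1 n v) < 1"
  shows "spd n (M + (- s) \<cdot>\<^sub>m rank1 n v)"
  unfolding spd_def
proof (intro conjI ballI impI)
  note cM = spd_carrier[OF M]
  show "M + (- s) \<cdot>\<^sub>m rank1 n v \<in> carrier_mat n n" by simp
  show "transpose_mat (M + (- s) \<cdot>\<^sub>m rank1 n v) = M + (- s) \<cdot>\<^sub>m rank1 n v"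
    using transpose_add[OF cM, of "(- s) \<cdot>\<^sub>m rank1 n v"] spd_sym[OF M] by (simp add: transpose_smult_mat)
  fix x :: "real Matrix.vec" assume x: "x \<in> carrier_vec n" "x \<noteq> 0\<^sub>v n"
  define \<alpha> where "\<alpha> = vec n v \<bullet> x"
  define c where "c = tr (P * rank1 n v)"
  have v: "vec n v \<in> carrier_vec n" by simp
  \<comment> \<open>The multiple \<open>s * \<alpha>\<close> of \<open>v\<close> is chosen so that
    the Fenchel bound exceeds the subtracted amount \<open>s * \<alpha>\<^sup>2\<close> by a surplus
    carrying the factor \<open>1 - s * c\<close>, positive by assumption. If
    \<open>s * \<alpha>\<^sup>2\<close> vanishes, strictness comes from \<open>M\<close>
    itself.\<close>
  have "2 * (((s * \<alpha>) \<cdot>\<^sub>v vec n v) \<bullet> x) - ((s * \<alpha>) \<cdot>\<^sub>v vec n v) \<bullet> (P *\<^sub>v ((s * \<alpha>) \<cdot>\<^sub>v vec n v))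
      \<le> x \<bullet> (M *\<^sub>v x)"
    using x by (intro spd_fenchel[OF M P]) auto
  also have "P *\<^sub>v ((s * \<alpha>) \<cdot>\<^sub>v vec n v) = (s * \<alpha>) \<cdot>\<^sub>v (P *\<^sub>v vec n v)"
    using mult_mat_vec[OF P(1) v] by simp
  also have "2 * (((s * \<alpha>) \<cdot>\<^sub>v vec n v) \<bullet> x) - ((s * \<alpha>) \<cdot>\<^sub>v vec n v) \<bullet> ((s * \<alpha>) \<cdot>\<^sub>v (P *\<^sub>v vec n v))
      = s * \<alpha>\<^sup>2 + s * \<alpha>\<^sup>2 * (1 - s * c)"
    using P x by (simp add: rank1_quadratic_form[OF P(1)] \<alpha>_def[symmetric] c_def[symmetric])
      (simp add: algebra_simps power2_eq_square)
  finally have *: "s * \<alpha>\<^sup>2 + s * \<alpha>\<^sup>2 * (1 - s * c) \<le> x \<bullet> (M *\<^sub>v x)" .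
  have "s * \<alpha>\<^sup>2 < x \<bullet> (M *\<^sub>v x)"
  proof (cases "s * \<alpha>\<^sup>2 = 0")
    case True
    then show ?thesis using spd_pos[OF M x] by auto
  next
    case False
    with s(1) have "0 < s * \<alpha>\<^sup>2" by (simp add: less_le)
    then have "0 < s * \<alpha>\<^sup>2 * (1 - s * c)" using s(2) by (simp add: c_def)
    with * show ?thesis by linarith
  qed
  then show "0 < x \<bullet> ((M + (- s) \<cdot>\<^sub>m rank1 n v) *\<^sub>v x)"
    using x by (simp add: quadratic_form_add_rank1[OF cM] \<alpha>_def)
qed

lemma spd_quadratic_le_trace:
  assumes P: "spd n P" and x: "x \<in> carrier_vec n" "x \<noteq> 0\<^sub>v n"
  shows "x \<bullet> (P *\<^sub>v x) \<le> tr P * (x \<bullet> x)"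
proof -
  note cP = spd_carrier[OF P]
  obtain v where v: "x = vec n v"
    using x(1) by (metis vec_of_dim_0 carrier_vecD dim_vec eq_vecI index_vec)
  define V where "V = rank1 n v"
  define \<beta> where "\<beta> = x \<bullet> x"
  define a where "a = tr (P * V)"
  have V [simp]: "V \<in> carrier_mat n n" by (simp add: V_def)
  have beta: "0 < \<beta>" using x unfolding \<beta>_def
    by (rule scalar_prod_self_pos)
  have trV: "tr V = \<beta>"
    by (simp add: V_def \<beta>_def v tr_def rank1_def scalar_prod_def atLeast0LessThan)
  have ax: "a = x \<bullet> (P *\<^sub>v x)" unfolding a_def V_def v rank1_quadratic_form[OF cP] ..
  \<comment> \<open>\<open>X\<close> is the orthogonal projection along \<open>x\<close>; the claim is \<open>tr (X P X) \<ge> 0\<close>.\<close>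
  let ?X = "1\<^sub>m n - (1 / \<beta>) \<cdot>\<^sub>m V"
  have X: "?X \<in> carrier_mat n n" by simp
  have "transpose_mat ?X = ?X"
    using transpose_minus[of "1\<^sub>m n" n n "(1 / \<beta>) \<cdot>\<^sub>m V"] by (simp add: transpose_smult_mat V_def)
  then have "0 \<le> tr (?X * (P * ?X))" using tr_conj_nonneg[OF P X] by simp
  also have "P * ?X = P - (1 / \<beta>) \<cdot>\<^sub>m (P * V)"
    using mult_minus_distrib_mat[of P n n "1\<^sub>m n" n "(1 / \<beta>) \<cdot>\<^sub>m V"]
      mult_smult_distrib[OF cP V, of "1 / \<beta>"] cP right_mult_one_mat[OF cP] by simp
  also have "?X * \<dots> = \<dots> - (1 / \<beta>) \<cdot>\<^sub>m (V * \<dots>)"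
    using minus_mult_distrib_mat[of "1\<^sub>m n" n n "(1 / \<beta>) \<cdot>\<^sub>m V" "P - (1 / \<beta>) \<cdot>\<^sub>m (P * V)" n]
      mult_smult_assoc_mat[of V n n "P - (1 / \<beta>) \<cdot>\<^sub>m (P * V)" n "1 / \<beta>"] cP by simp
  also have "V * (P - (1 / \<beta>) \<cdot>\<^sub>m (P * V)) = V * P - (1 / \<beta>) \<cdot>\<^sub>m (a \<cdot>\<^sub>m V)"
    using mult_minus_distrib_mat[of V n n P n "(1 / \<beta>) \<cdot>\<^sub>m (P * V)"]
      mult_smult_distrib[of V n n "P * V" n "1 / \<beta>"] rank1_sandwich[OF cP, of v] cP
    by (simp add: V_def a_def)
  also have "tr (P - (1 / \<beta>) \<cdot>\<^sub>m (P * V) - (1 / \<beta>) \<cdot>\<^sub>m (V * P - (1 / \<beta>) \<cdot>\<^sub>m (a \<cdot>\<^sub>m V)))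
    = tr P - (1 / \<beta>) * a - (1 / \<beta>) * (a - (1 / \<beta>) * (a * \<beta>))"
    using cP by (simp add: tr_diff[of _ n] tr_smult[of _ n] tr_mult_comm[OF V cP] a_def[symmetric] trV)
  also have "\<dots> = tr P - a / \<beta>" using beta by simp
  finally have "a / \<beta> \<le> tr P" by simp
  then show ?thesis using beta ax by (simp add: \<beta>_def field_simps)
qed

text \<open>Since the inverse \<open>Q\<close> has trace below 1, its form is strictly below the
  form of the identity; the Fenchel inequality with \<open>v = x\<close> turns this into the reverse
  bound for \<open>N\<close>. Hence a lower barrier whose potential is below 1 can advance by 1
  without meeting the spectrum.\<close>

lemma spd_minus_one:
  assumes N: "spd n N" and Q: "spd n Q" "N * Q = 1\<^sub>m n" "tr Q < 1"
  shows "spd n (N - 1\<^sub>m n)"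
  unfolding spd_def
proof (intro conjI ballI impI)
  note cN = spd_carrier[OF N]
  show "N - 1\<^sub>m n \<in> carrier_mat n n" by simp
  show "transpose_mat (N - 1\<^sub>m n) = N - 1\<^sub>m n"
    using transpose_minus[OF cN, of "1\<^sub>m n"] spd_sym[OF N] by simp
  fix x :: "real Matrix.vec" assume x: "x \<in> carrier_vec n" "x \<noteq> 0\<^sub>v n"
  have "0 < x \<bullet> x" using x
    by (rule scalar_prod_self_pos)
  then have "tr Q * (x \<bullet> x) < x \<bullet> x" using Q(3) by simp
  then have "x \<bullet> x < x \<bullet> (N *\<^sub>v x)"
    using spd_fenchel[OF N spd_carrier[OF Q(1)] Q(2) x(1) x(1)] spd_quadratic_le_trace[OF Q(1) x]
    by simp
  then show "0 < x \<bullet> ((N - 1\<^sub>m n) *\<^sub>v x)"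
    using minus_mult_distrib_mat_vec[OF cN, of "1\<^sub>m n" x]
      scalar_prod_minus_distrib[of x n "N *\<^sub>v x" x] x cN by simp
qed

text \<open>The Sherman-Morrison formula, with the exact change of the trace of the inverse. The
  coefficient \<open>r\<close> is negative for the upper barrier and positive for the lower
  one.\<close>

lemma rank1_update_inverse:
  assumes M: "M \<in> carrier_mat n n" and P: "P \<in> carrier_mat n n" "M * P = 1\<^sub>m n"
    and c: "c = tr (P * rank1 n v)" "1 + r * c \<noteq> 0"
  defines "P1 \<equiv> P - (r / (1 + r * c)) \<cdot>\<^sub>m (P * (rank1 n v * P))"
  shows "(M + r \<cdot>\<^sub>m rank1 n v) * P1 = 1\<^sub>m n"
    and "tr P1 = tr P - r / (1 + r * c) * tr ((P * P) * rank1 n v)"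
proof -
  define V where "V = rank1 n v"
  define t where "t = r / (1 + r * c)"
  have V: "V \<in> carrier_mat n n" by (simp add: V_def)
  define W where "W = V * P"
  have W: "W \<in> carrier_mat n n" using V P by (simp add: W_def)
  have PW: "P * W \<in> carrier_mat n n" using W P by simp
  have MPW: "M * (P * W) = W"
    using assoc_mult_mat[OF M P(1) W] P W by simp
  have VPW: "V * (P * W) = c \<cdot>\<^sub>m W"
  proof -
    have "V * (P * W) = (V * (P * V)) * P"
      using assoc_mult_mat[OF V _ P(1), of "P * V"] assoc_mult_mat[OF P(1) V P(1)] P V
      by (simp add: W_def)
    also have "\<dots> = c \<cdot>\<^sub>m W"
      using rank1_sandwich[OF P(1), of v] mult_smult_assoc_mat[OF V P(1), of c]
      by (simp add: V_def c W_def)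
    finally show ?thesis .
  qed
  have P1: "P1 = P - t \<cdot>\<^sub>m (P * W)" by (simp add: P1_def W_def V_def t_def)
  have cP1: "P1 \<in> carrier_mat n n" unfolding P1 using PW by simp
  have "M * P1 = 1\<^sub>m n - t \<cdot>\<^sub>m W"
    unfolding P1 using mult_minus_distrib_mat[OF M P(1), of "t \<cdot>\<^sub>m (P * W)"]
      mult_smult_distrib[OF M PW, of t] MPW P PW by simp
  moreover have "V * P1 = W - t \<cdot>\<^sub>m (c \<cdot>\<^sub>m W)"
    unfolding P1 using mult_minus_distrib_mat[OF V P(1), of "t \<cdot>\<^sub>m (P * W)"]
      mult_smult_distrib[OF V PW, of t] VPW P PW by (simp add: W_def)
  ultimately have "(M + r \<cdot>\<^sub>m V) * P1 = (1\<^sub>m n - t \<cdot>\<^sub>m W) + r \<cdot>\<^sub>m (W - t \<cdot>\<^sub>m (c \<cdot>\<^sub>m W))"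
    using add_mult_distrib_mat[OF M _ cP1, of "r \<cdot>\<^sub>m V"] mult_smult_assoc_mat[OF V cP1, of r] V
    by simp
  \<comment> \<open>The total coefficient of \<open>W\<close> is -t + r - r t c, which is zero
    because t (1 + r c) = r.\<close>
  also have "\<dots> = 1\<^sub>m n"
  proof -
    have "t * (1 + r * c) = r" using c(2) by (simp add: t_def)
    moreover have "t * w + r * (t * (c * w)) = t * (1 + r * c) * w" for w
      by (simp add: algebra_simps)
    ultimately have rw: "r * w = t * w + r * (t * (c * w))" for w by metis
    have cancel: "a - t * w + r * (w - t * (c * w)) = a" for a w :: real
      using rw[of w] right_diff_distrib[of r w "t * (c * w)"] by linarith
    show ?thesis
    proof (rule eq_matI)
      fix i j assume "i < dim_row (1\<^sub>m n :: real mat)" "j < dim_col (1\<^sub>m n :: real mat)"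
      then have ij: "i < n" "j < n" by auto
      have "(1\<^sub>m n - t \<cdot>\<^sub>m W + r \<cdot>\<^sub>m (W - t \<cdot>\<^sub>m (c \<cdot>\<^sub>m W))) $$ (i, j)
          = 1\<^sub>m n $$ (i, j) - t * W $$ (i, j) + r * (W $$ (i, j) - t * (c * W $$ (i, j)))"
        using W ij by simp
      then show "(1\<^sub>m n - t \<cdot>\<^sub>m W + r \<cdot>\<^sub>m (W - t \<cdot>\<^sub>m (c \<cdot>\<^sub>m W))) $$ (i, j) = 1\<^sub>m n $$ (i, j)"
        by (simp only: cancel)
    qed (use W in auto)
  qed
  finally show "(M + r \<cdot>\<^sub>m rank1 n v) * P1 = 1\<^sub>m n" by (simp add: V_def)
  have "tr P1 = tr P - t * tr (P * W)"
    unfolding P1 using P PW by (simp add: tr_diff[of _ n] tr_smult[of _ n])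
  also have "tr (P * W) = tr (W * P)" by (rule tr_mult_comm[OF P(1) W])
  also have "W * P = V * (P * P)" unfolding W_def by (rule assoc_mult_mat[OF V P(1) P(1)])
  also have "tr \<dots> = tr ((P * P) * V)" using V P by (intro tr_mult_comm[of _ n]) auto
  finally show "tr P1 = tr P - r / (1 + r * c) * tr ((P * P) * rank1 n v)"
    by (simp add: t_def V_def)
qed

text \<open>Both barriers are treated by one notion: \<open>M\<close> stands for u I - A or for A -
  l I, and the trace of its inverse is the sum of the reciprocal distances from the eigenvalues of A
  to the barrier.\<close>

definition potential_le :: "nat \<Rightarrow> real \<Rightarrow> real mat \<Rightarrow> bool" where
  "potential_le n \<eta> M \<longleftrightarrow>
     spd n M \<and> (\<exists>P. spd n P \<and> M * P = 1\<^sub>m n \<and> P * M = 1\<^sub>m n \<and> tr P \<le> \<eta>)"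

text \<open>A right inverse is enough, because it coincides with the positive definite inverse from
  \<open>spd_inverse\<close>. Sherman-Morrison supplies just a right inverse.\<close>

lemma potential_leI:
  assumes M: "spd n M" and P: "P \<in> carrier_mat n n" "M * P = 1\<^sub>m n" "tr P \<le> \<eta>"
  shows "potential_le n \<eta> M"
proof -
  obtain Q where Q: "spd n Q" "M * Q = 1\<^sub>m n" "Q * M = 1\<^sub>m n" by (rule spd_inverse[OF M])
  have "Q = (Q * M) * P"
    using assoc_mult_mat[OF spd_carrier[OF Q(1)] spd_carrier[OF M] P(1)] P Q
      right_mult_one_mat[OF spd_carrier[OF Q(1)]] by simp
  then have "Q = P" using Q P by simp
  with Q P M show ?thesis by (auto simp: potential_le_def)
qed

text \<open>For symmetric \<open>P\<close> this trace is the squared Euclidean norm of P v.\<close>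

lemma tr_square_rank1_nonneg:
  assumes P: "spd n P"
  shows "0 \<le> tr ((P * P) * rank1 n v)"
proof -
  note cP = spd_carrier[OF P]
  have v: "vec n v \<in> carrier_vec n" by simp
  have Pv: "P *\<^sub>v vec n v \<in> carrier_vec n" using cP by simp
  have "tr ((P * P) * rank1 n v) = vec n v \<bullet> ((P * P) *\<^sub>v vec n v)"
    using rank1_quadratic_form[of "P * P" n v] cP by simp
  also have "\<dots> = (P *\<^sub>v vec n v) \<bullet> (P *\<^sub>v vec n v)"
    using spd_inner_comm[OF P v Pv] assoc_mult_mat_vec[OF cP cP v] by simp
  also have "\<dots> \<ge> 0" by (simp add: scalar_prod_def sum_nonneg)
  finally show ?thesis .
qed

lemma tr_spd_rank1_nonneg:
  assumes P: "spd n P"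
  shows "0 \<le> tr (P * rank1 n v)"
  unfolding rank1_quadratic_form[OF spd_carrier[OF P], symmetric] by (intro spd_nonneg[OF P]) simp

section \<open>The barrier argument\<close>

text \<open>Moving the barrier by \<open>d\<close> lowers the potential by D = d tr (P P').
  Subtracting s v v^T raises it by s b / (1 - s c), where b and c are the forms of P'^2 and P' at v.
  The rise is at most D once s (b / D + c) < 1, and b / D + c is the form at v of \<open>B\<close> =
  P'^2 / D + P'. Its trace is at most 1 / d + \<eta> because D is at least d tr (P'^2).\<close>

lemma barrier_upper:
  assumes M: "potential_le n \<eta> M" and d: "0 < d" and n: "0 < n"
  obtains B where "B \<in> carrier_mat n n" "tr B \<le> 1 / d + \<eta>" "\<And>v. 0 \<le> tr (B * rank1 n v)"
    "\<And>v s. 0 < s \<Longrightarrow> s * tr (B * rank1 n v) < 1 \<Longrightarrow>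
       potential_le n \<eta> ((M + d \<cdot>\<^sub>m 1\<^sub>m n) + (- s) \<cdot>\<^sub>m rank1 n v)"
proof -
  from M obtain P where spdM: "spd n M" and P: "spd n P" "P * M = 1\<^sub>m n" "tr P \<le> \<eta>"
    by (auto simp: potential_le_def)
  note cM = spd_carrier[OF spdM]
  define M' where "M' = M + d \<cdot>\<^sub>m 1\<^sub>m n"
  have cM': "M' \<in> carrier_mat n n" by (simp add: M'_def)
  have M': "spd n M'"
    unfolding spd_def
  proof (intro conjI ballI impI cM')
    show "transpose_mat M' = M'"
      using transpose_add[OF cM, of "d \<cdot>\<^sub>m 1\<^sub>m n"] spd_sym[OF spdM] by (simp add: transpose_smult_mat M'_def)
    fix x :: "real Matrix.vec" assume x: "x \<in> carrier_vec n" "x \<noteq> 0\<^sub>v n"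
    have "M' *\<^sub>v x = M *\<^sub>v x + d \<cdot>\<^sub>v x"
      using add_mult_distrib_mat_vec[OF cM _ x(1), of "d \<cdot>\<^sub>m 1\<^sub>m n"]
        smult_mat_mult_vec[OF one_carrier_mat x(1), of d] x by (simp add: M'_def)
    then show "0 < x \<bullet> (M' *\<^sub>v x)"
      using scalar_prod_add_distrib[OF x(1), of "M *\<^sub>v x" "d \<cdot>\<^sub>v x"] x cM d
        spd_pos[OF spdM x] scalar_prod_self_pos[OF x] by (simp add: add_pos_pos)
  qed
  obtain P' where P': "spd n P'" "M' * P' = 1\<^sub>m n" by (rule spd_inverse[OF M'])
  note cP = spd_carrier[OF P(1)] and cP' = spd_carrier[OF P'(1)]
  note traces = resolvent_traces[OF cM P(1,2) P'(1) P'(2)[unfolded M'_def]]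
  have sq: "0 < tr (P' * P')" by (rule tr_square_pos[OF P'(1) n])
  have le: "tr (P' * P') \<le> tr (P * P')"
    using traces(2) tr_conj_spd_nonneg[OF P(1) P'(1)] d by simp
  define D where "D = d * tr (P * P')"
  have D: "0 < D" using d sq le by (simp add: D_def)
  have trP: "tr P = tr P' + D" using traces(1) by (simp add: D_def)
  define B where "B = (1 / D) \<cdot>\<^sub>m (P' * P') + P'"
  have BV: "tr (B * rank1 n v) = (1 / D) * tr ((P' * P') * rank1 n v) + tr (P' * rank1 n v)" for v
    using add_mult_distrib_mat[of "(1 / D) \<cdot>\<^sub>m (P' * P')" n n P' "rank1 n v" n]
      mult_smult_assoc_mat[of "P' * P'" n n "rank1 n v" n "1 / D"] cP'
    by (simp add: B_def tr_add[of _ n] tr_smult[of _ n] del: assoc_mult_mat)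
  show thesis
  proof (rule that)
    show "B \<in> carrier_mat n n" using cP' by (simp add: B_def)
    have "d * tr (P' * P') \<le> D" unfolding D_def using le d by simp
    then have "tr (P' * P') / D \<le> 1 / d" using D d by (simp add: field_simps)
    moreover have "tr B = tr (P' * P') / D + tr P'"
      using cP' by (simp add: B_def tr_add[of _ n] tr_smult[of _ n])
    ultimately show "tr B \<le> 1 / d + \<eta>" using trP D P(3) by simp
    show "0 \<le> tr (B * rank1 n v)" for v
      unfolding BV using D tr_square_rank1_nonneg[OF P'(1)] tr_spd_rank1_nonneg[OF P'(1)] by simp
    fix v and s :: real assume s: "0 < s" and lt: "s * tr (B * rank1 n v) < 1"
    define b where "b = tr ((P' * P') * rank1 n v)"
    define c where "c = tr (P' * rank1 n v)"
    have b: "0 \<le> b" unfolding b_def by (rule tr_square_rank1_nonneg[OF P'(1)])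
    have lt': "s * (b / D) + s * c < 1"
      using lt by (simp add: BV b_def c_def algebra_simps)
    have "0 \<le> s * (b / D)" using s b D by simp
    with lt' have sc: "s * c < 1" by linarith
    have spd: "spd n (M' + (- s) \<cdot>\<^sub>m rank1 n v)"
      using spd_diff_rank1[OF M' cP' P'(2)] s sc by (simp add: c_def)
    have nz: "1 + (- s) * c \<noteq> 0" using sc by simp
    note upd = rank1_update_inverse[OF cM' cP' P'(2) c_def nz]
    have "s * b \<le> D * (1 - s * c)" using lt' D by (simp add: field_simps)
    then have "s / (1 - s * c) * b \<le> D" using sc by (simp add: field_simps)
    with upd(2) trP P(3) have "tr (P' - (- s / (1 + - s * c)) \<cdot>\<^sub>m (P' * (rank1 n v * P'))) \<le> \<eta>"
      by (simp add: b_def)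
    then show "potential_le n \<eta> ((M + d \<cdot>\<^sub>m 1\<^sub>m n) + (- s) \<cdot>\<^sub>m rank1 n v)"
      using potential_leI[OF spd _ upd(1)] cP' by (simp add: M'_def)
  qed
qed

text \<open>Moving the barrier by 1 raises the potential by a = tr (P Q). Adding s v v^T lowers it
  by s d / (1 + s c), where d and c are the forms of P^2 and P at v. This pays for the rise exactly
  when 1 \<le> s (d / a - c), and d / a - c is the form at v of \<open>B\<close> = P^2 / a -
  P.\<close>

lemma barrier_lower:
  assumes N: "potential_le n \<eta> N" and eta: "\<eta> < 1" and n: "0 < n"
  obtains B where "B \<in> carrier_mat n n" "1 - \<eta> \<le> tr B"
    "\<And>v s. 0 < s \<Longrightarrow> 1 \<le> s * tr (B * rank1 n v) \<Longrightarrow>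
       potential_le n \<eta> ((N - 1\<^sub>m n) + s \<cdot>\<^sub>m rank1 n v)"
proof -
  from N obtain Q where spdN: "spd n N" and Q: "spd n Q" "N * Q = 1\<^sub>m n" "tr Q \<le> \<eta>"
    by (auto simp: potential_le_def)
  note cN = spd_carrier[OF spdN]
  define N' where "N' = N - 1\<^sub>m n"
  have N': "spd n N'"
    unfolding N'_def using Q eta by (intro spd_minus_one[OF spdN Q(1,2)]) simp
  note cN' = spd_carrier[OF N']
  obtain P where P: "spd n P" "N' * P = 1\<^sub>m n" "P * N' = 1\<^sub>m n" by (rule spd_inverse[OF N'])
  note cP = spd_carrier[OF P(1)] and cQ = spd_carrier[OF Q(1)]
  \<comment> \<open>The resolvent formulas are used starting from the moved matrix
    \<open>N'\<close>: the shift by 1 leads back to \<open>N\<close>, so the inverse after the move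
    is \<open>P\<close> and the one before is \<open>Q\<close>.\<close>
  have "N = N' + 1 \<cdot>\<^sub>m 1\<^sub>m n" using cN by (auto simp: N'_def intro!: eq_matI)
  with Q(2) have NQ: "(N' + 1 \<cdot>\<^sub>m 1\<^sub>m n) * Q = 1\<^sub>m n" by simp
  note traces = resolvent_traces[OF cN' P(1,3) Q(1) NQ]
  define a where "a = tr (P * Q)"
  define b where "b = tr (P * (Q * P))"
  have a: "0 < a"
    using traces(2) tr_square_pos[OF Q(1) n] tr_conj_spd_nonneg[OF P(1) Q(1)] by (simp add: a_def)
  have trP: "tr P = tr Q + a" and trPP: "tr (P * P) = a + b"
    using traces(1,3) by (simp_all add: a_def b_def)
  have b: "0 \<le> b" unfolding b_def by (rule tr_conj_spd_nonneg[OF Q(1) P(1)])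
  \<comment> \<open>The trace of \<open>B\<close> equals 1 + b / a - tr Q - a. Cauchy-Schwarz and tr
    Q < 1 show that b / a compensates the loss a.\<close>
  have "a\<^sup>2 \<le> b * tr Q" unfolding a_def b_def by (rule tr_cauchy_schwarz[OF Q(1) P(1) n])
  also have "\<dots> \<le> b * 1" using b Q(3) eta by (intro mult_left_mono) auto
  finally have ab: "a \<le> b / a" using a by (simp add: field_simps power2_eq_square)
  define B where "B = (1 / a) \<cdot>\<^sub>m (P * P) - P"
  have BV: "tr (B * rank1 n v) = (1 / a) * tr ((P * P) * rank1 n v) - tr (P * rank1 n v)" for v
    using minus_mult_distrib_mat[of "(1 / a) \<cdot>\<^sub>m (P * P)" n n P "rank1 n v" n]
      mult_smult_assoc_mat[of "P * P" n n "rank1 n v" n "1 / a"] cP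
    by (simp add: B_def tr_diff[of _ n] tr_smult[of _ n] del: assoc_mult_mat)
  show thesis
  proof (rule that)
    show "B \<in> carrier_mat n n" using cP by (simp add: B_def)
    have "tr B = (a + b) / a - tr P"
      using cP by (simp add: B_def tr_diff[of _ n] tr_smult[of _ n] trPP)
    also have "(a + b) / a = 1 + b / a" using a by (simp add: field_simps)
    finally show "1 - \<eta> \<le> tr B" using ab trP Q(3) by simp
    fix v and s :: real assume s: "0 < s" and ge: "1 \<le> s * tr (B * rank1 n v)"
    define d where "d = tr ((P * P) * rank1 n v)"
    define c where "c = tr (P * rank1 n v)"
    have c: "0 \<le> c" unfolding c_def by (rule tr_spd_rank1_nonneg[OF P(1)])
    have sc: "0 < 1 + s * c" using s c by (simp add: add_pos_nonneg)
    then have nz: "1 + s * c \<noteq> 0" by simp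
    have spd: "spd n (N' + s \<cdot>\<^sub>m rank1 n v)" using spd_add_rank1[OF N'] s by simp
    note upd = rank1_update_inverse[OF cN' cP P(2) c_def nz]
    have "1 \<le> s * (d / a) - s * c"
      using ge by (simp add: BV d_def c_def algebra_simps)
    then have "a * (1 + s * c) \<le> s * d" using a by (simp add: field_simps)
    then have "a \<le> s / (1 + s * c) * d" using sc by (simp add: field_simps)
    with upd(2) trP Q(3) have "tr (P - (s / (1 + s * c)) \<cdot>\<^sub>m (P * (rank1 n v * P))) \<le> \<eta>"
      by (simp add: d_def)
    then show "potential_le n \<eta> ((N - 1\<^sub>m n) + s \<cdot>\<^sub>m rank1 n v)"
      using potential_leI[OF spd _ upd(1)] cP by (simp add: N'_def)
  qed
qed

text \<open>Orthonormality says that v(t) v(t)^T integrates to the identity matrix, and the trace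
  against \<open>B\<close> is linear.\<close>

lemma integral_tr_rank1:
  fixes v :: "nat \<Rightarrow> 'a \<Rightarrow> real"
  assumes int: "\<And>i j. i < m \<Longrightarrow> j < m \<Longrightarrow> integrable M (\<lambda>t. v i t * v j t)"
    and orth: "\<And>i j. i < m \<Longrightarrow> j < m \<Longrightarrow> (\<integral>t. v i t * v j t \<partial>M) = (if i = j then 1 else 0)"
    and B: "B \<in> carrier_mat m m"
  shows "integrable M (\<lambda>t. tr (B * rank1 m (\<lambda>i. v i t)))"
    and "(\<integral>t. tr (B * rank1 m (\<lambda>i. v i t)) \<partial>M) = tr B"
proof -
  show "integrable M (\<lambda>t. tr (B * rank1 m (\<lambda>i. v i t)))"
    unfolding tr_mult_rank1[OF B] using int by (intro Bochner_Integration.integrable_sum) auto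
  have "(\<integral>t. tr (B * rank1 m (\<lambda>i. v i t)) \<partial>M)
      = (\<Sum>i<m. \<Sum>j<m. B $$ (i, j) * (\<integral>t. v j t * v i t \<partial>M))"
    unfolding tr_mult_rank1[OF B] using int
    by (subst Bochner_Integration.integral_sum; (intro Bochner_Integration.integrable_sum)?; simp)+
  also have "\<dots> = (\<Sum>i<m. \<Sum>j<m. if j = i then B $$ (i, i) else 0)"
    using orth by (intro sum.cong) auto
  also have "\<dots> = tr B" using B by (simp add: tr_def)
  finally show "(\<integral>t. tr (B * rank1 m (\<lambda>i. v i t)) \<partial>M) = tr B" .
qed

text \<open>The forms of the upper matrix \<open>U\<close> and the lower matrix \<open>L\<close> at
  v(t) have integrals tr U \<le> 1 / d + \<eta> < 1 - \<eta> \<le> tr L, so the first is strictly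
  smaller than the second at some point \<open>t\<close>. The predicate \<open>good\<close> keeps
  the choice off a null set.\<close>

lemma barrier_step:
  fixes v :: "nat \<Rightarrow> 'a \<Rightarrow> real"
  assumes int: "\<And>i j. i < m \<Longrightarrow> j < m \<Longrightarrow> integrable \<mu> (\<lambda>t. v i t * v j t)"
    and orth: "\<And>i j. i < m \<Longrightarrow> j < m \<Longrightarrow> (\<integral>t. v i t * v j t \<partial>\<mu>) = (if i = j then 1 else 0)"
    and good: "AE t in \<mu>. good t" and m: "0 < m"
    and M: "potential_le m \<eta> M" and N: "potential_le m \<eta> N"
    and d: "0 < d" and eta: "\<eta> < 1" "1 / d + 2 * \<eta> < 1"
  obtains t s where "good t" "0 < s"
    "potential_le m \<eta> ((M + d \<cdot>\<^sub>m 1\<^sub>m m) + (- s) \<cdot>\<^sub>m rank1 m (\<lambda>i. v i t))"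
    "potential_le m \<eta> ((N - 1\<^sub>m m) + s \<cdot>\<^sub>m rank1 m (\<lambda>i. v i t))"
proof -
  obtain U where U: "U \<in> carrier_mat m m" "tr U \<le> 1 / d + \<eta>" "\<And>v. 0 \<le> tr (U * rank1 m v)"
    "\<And>v s. 0 < s \<Longrightarrow> s * tr (U * rank1 m v) < 1 \<Longrightarrow>
       potential_le m \<eta> ((M + d \<cdot>\<^sub>m 1\<^sub>m m) + (- s) \<cdot>\<^sub>m rank1 m v)"
    by (rule barrier_upper[OF M d m]) blast
  obtain L where L: "L \<in> carrier_mat m m" "1 - \<eta> \<le> tr L"
    "\<And>v s. 0 < s \<Longrightarrow> 1 \<le> s * tr (L * rank1 m v) \<Longrightarrow>
       potential_le m \<eta> ((N - 1\<^sub>m m) + s \<cdot>\<^sub>m rank1 m v)"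
    by (rule barrier_lower[OF N eta(1) m]) blast
  define V where "V t = rank1 m (\<lambda>i. v i t)" for t
  note intU = integral_tr_rank1[OF int orth U(1), folded V_def]
  note intL = integral_tr_rank1[OF int orth L(1), folded V_def]
  have "\<exists>t. good t \<and> tr (U * V t) < tr (L * V t)"
  proof (rule ccontr)
    assume "\<nexists>t. good t \<and> tr (U * V t) < tr (L * V t)"
    then have "AE t in \<mu>. tr (L * V t) \<le> tr (U * V t)"
      using good by (auto elim!: eventually_mono simp: not_less)
    then have "(\<integral>t. tr (L * V t) \<partial>\<mu>) \<le> (\<integral>t. tr (U * V t) \<partial>\<mu>)"
      by (intro integral_mono_AE intU intL)
    then show False using intU(2) intL(2) U(2) L(2) eta by simp
  qed
  then obtain t where t: "good t" "tr (U * V t) < tr (L * V t)" by blast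
  \<comment> \<open>The reciprocal of \<open>s\<close> is the upper end of the interval of
    admissible values: the lower barrier allows equality, while the upper barrier needs the strict
    inequality found for \<open>t\<close>.\<close>
  define s where "s = 1 / tr (L * V t)"
  have pos: "0 < tr (L * V t)" using t(2) U(3)[of "\<lambda>i. v i t"] by (simp add: V_def)
  show thesis
  proof (rule that[OF t(1)])
    show s: "0 < s" using pos by (simp add: s_def)
    have "s * tr (U * V t) < 1" using t(2) pos by (simp add: s_def field_simps)
    then show "potential_le m \<eta> ((M + d \<cdot>\<^sub>m 1\<^sub>m m) + (- s) \<cdot>\<^sub>m rank1 m (\<lambda>i. v i t))"
      unfolding V_def by (rule U(4)[OF s])
    have "1 \<le> s * tr (L * V t)" using pos by (simp add: s_def)
    then show "potential_le m \<eta> ((N - 1\<^sub>m m) + s \<cdot>\<^sub>m rank1 m (\<lambda>i. v i t))"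
      unfolding V_def by (rule L(3)[OF s])
  qed
qed

text \<open>This supplies the start of the iteration, where A = 0.\<close>

lemma potential_le_scaled_one:
  assumes "0 < c" "real m / c \<le> \<eta>"
  shows "potential_le m \<eta> (c \<cdot>\<^sub>m 1\<^sub>m m)"
proof (rule potential_leI)
  show "spd m (c \<cdot>\<^sub>m 1\<^sub>m m)"
    unfolding spd_def
  proof (intro conjI ballI impI)
    fix x :: "real Matrix.vec" assume x: "x \<in> carrier_vec m" "x \<noteq> 0\<^sub>v m"
    show "0 < x \<bullet> ((c \<cdot>\<^sub>m 1\<^sub>m m) *\<^sub>v x)"
      using scalar_prod_self_pos[OF x] smult_mat_mult_vec[OF one_carrier_mat x(1), of c] assms(1) x by simp
  qed (auto simp: transpose_smult_mat)
  show "(1 / c) \<cdot>\<^sub>m 1\<^sub>m m \<in> carrier_mat m m" by simp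
  show "(c \<cdot>\<^sub>m 1\<^sub>m m) * ((1 / c) \<cdot>\<^sub>m 1\<^sub>m m) = 1\<^sub>m m"
    using mult_smult_assoc_mat[of "1\<^sub>m m" m m "(1 / c) \<cdot>\<^sub>m 1\<^sub>m m" m c] assms(1)
    by (auto intro!: eq_matI)
  show "tr ((1 / c) \<cdot>\<^sub>m 1\<^sub>m m) \<le> \<eta>"
    using assms(2) by (simp add: tr_def)
qed

text \<open>After \<open>n\<close> steps M = u I - A and N = A - l I, where A is the sum of the
  weighted matrices v(t) v(t)^T, u = m / \<eta> + n d and l = n - m / \<eta>. The identities are
  stated for quadratic forms, so A itself is never built.\<close>

definition barrier_forms ::
    "nat \<Rightarrow> real \<Rightarrow> real \<Rightarrow> (nat \<Rightarrow> 'a \<Rightarrow> real) \<Rightarrow> nat \<Rightarrow> (nat \<Rightarrow> real) \<Rightarrow> (nat \<Rightarrow> 'a) \<Rightarrow>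
       real mat \<Rightarrow> real mat \<Rightarrow> bool" where
  "barrier_forms m \<eta> d v n s t M N \<longleftrightarrow> (\<forall>x\<in>carrier_vec m.
     x \<bullet> (M *\<^sub>v x) = (m / \<eta> + n * d) * (x \<bullet> x) - (\<Sum>i<n. s i * (vec m (\<lambda>j. v j (t i)) \<bullet> x)\<^sup>2) \<and>
     x \<bullet> (N *\<^sub>v x) = (m / \<eta> - n) * (x \<bullet> x) + (\<Sum>i<n. s i * (vec m (\<lambda>j. v j (t i)) \<bullet> x)\<^sup>2))"

lemma barrier_formsD:
  assumes "barrier_forms m \<eta> d v n s t M N" "x \<in> carrier_vec m"
  shows "x \<bullet> (M *\<^sub>v x) = (m / \<eta> + n * d) * (x \<bullet> x) - (\<Sum>i<n. s i * (vec m (\<lambda>j. v j (t i)) \<bullet> x)\<^sup>2)"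
    and "x \<bullet> (N *\<^sub>v x) = (m / \<eta> - n) * (x \<bullet> x) + (\<Sum>i<n. s i * (vec m (\<lambda>j. v j (t i)) \<bullet> x)\<^sup>2)"
  using assms unfolding barrier_forms_def by auto

lemma barrier_iteration:
  fixes v :: "nat \<Rightarrow> 'a \<Rightarrow> real" and n :: nat and d \<eta> :: real
  assumes int: "\<And>i j. i < m \<Longrightarrow> j < m \<Longrightarrow> integrable \<mu> (\<lambda>t. v i t * v j t)"
    and orth: "\<And>i j. i < m \<Longrightarrow> j < m \<Longrightarrow> (\<integral>t. v i t * v j t \<partial>\<mu>) = (if i = j then 1 else 0)"
    and good: "AE t in \<mu>. good t" and m: "0 < m"
    and d: "0 < d" and eta: "0 < \<eta>" "\<eta> < 1" "1 / d + 2 * \<eta> < 1"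
  shows "\<exists>M N s t. potential_le m \<eta> M \<and> potential_le m \<eta> N \<and>
    (\<forall>i<n. 0 < s i \<and> good (t i)) \<and> barrier_forms m \<eta> d v n s t M N"
proof (induction n)
  case 0
  \<comment> \<open>The barriers start at distance m / \<eta> on either side of A = 0, so one matrix
    serves for both and its potential is exactly \<eta>. Weights and points are arbitrary, the sums
    being empty.\<close>
  let ?M = "(m / \<eta>) \<cdot>\<^sub>m 1\<^sub>m m"
  have "potential_le m \<eta> ?M"
    using m eta(1) by (intro potential_le_scaled_one) auto
  moreover have "x \<bullet> (?M *\<^sub>v x) = (m / \<eta>) * (x \<bullet> x)" if "x \<in> carrier_vec m" for x
    using smult_mat_mult_vec[OF one_carrier_mat that, of "m / \<eta>"] that by simp
  ultimately show ?case
    by (intro exI[of _ ?M] exI[of _ undefined]) (auto simp: barrier_forms_def)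
next
  case (Suc n)
  then obtain M N s t where M: "potential_le m \<eta> M" and N: "potential_le m \<eta> N"
    and st: "\<And>i. i < n \<Longrightarrow> 0 < s i \<and> good (t i)"
    and MN: "barrier_forms m \<eta> d v n s t M N"
    by blast
  note Mx = barrier_formsD(1)[OF MN] and Nx = barrier_formsD(2)[OF MN]
  have cM: "M \<in> carrier_mat m m" and cN: "N \<in> carrier_mat m m"
    using M N by (auto simp: potential_le_def spd_def)
  obtain t' s' where t': "good t'" and s': "0 < s'"
    and M': "potential_le m \<eta> ((M + d \<cdot>\<^sub>m 1\<^sub>m m) + (- s') \<cdot>\<^sub>m rank1 m (\<lambda>i. v i t'))"
    and N': "potential_le m \<eta> ((N - 1\<^sub>m m) + s' \<cdot>\<^sub>m rank1 m (\<lambda>i. v i t'))"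
    by (rule barrier_step[OF int orth good m M N d eta(2,3)]) blast+
  let ?s = "s(n := s')" and ?t = "t(n := t')"
  have sum: "(\<Sum>i<Suc n. ?s i * (vec m (\<lambda>j. v j (?t i)) \<bullet> x)\<^sup>2)
      = (\<Sum>i<n. s i * (vec m (\<lambda>j. v j (t i)) \<bullet> x)\<^sup>2) + s' * (vec m (\<lambda>j. v j t') \<bullet> x)\<^sup>2" for x
    by simp
  have "x \<bullet> ((M + d \<cdot>\<^sub>m 1\<^sub>m m) *\<^sub>v x) = x \<bullet> (M *\<^sub>v x) + d * (x \<bullet> x)"
    "x \<bullet> ((N - 1\<^sub>m m) *\<^sub>v x) = x \<bullet> (N *\<^sub>v x) - x \<bullet> x" if x: "x \<in> carrier_vec m" for x
    using add_mult_distrib_mat_vec[OF cM _ x, of "d \<cdot>\<^sub>m 1\<^sub>m m"]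
      smult_mat_mult_vec[OF one_carrier_mat x(1), of d]
      scalar_prod_add_distrib[OF x, of "M *\<^sub>v x" "d \<cdot>\<^sub>v x"]
      minus_mult_distrib_mat_vec[OF cN _ x, of "1\<^sub>m m"]
      scalar_prod_minus_distrib[of x m "N *\<^sub>v x" x] x cM cN by simp_all
  note forms = this
  show ?case
  proof (rule exI[of _ "(M + d \<cdot>\<^sub>m 1\<^sub>m m) + (- s') \<cdot>\<^sub>m rank1 m (\<lambda>i. v i t')"],
      rule exI[of _ "(N - 1\<^sub>m m) + s' \<cdot>\<^sub>m rank1 m (\<lambda>i. v i t')"],
      rule exI[of _ ?s], rule exI[of _ ?t], unfold barrier_forms_def, intro conjI ballI M' N')
    show "\<forall>i<Suc n. 0 < ?s i \<and> good (?t i)" using st s' t' by (auto simp: less_Suc_eq)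
    fix x :: "real Matrix.vec" assume x: "x \<in> carrier_vec m"
    show "x \<bullet> ((M + d \<cdot>\<^sub>m 1\<^sub>m m + (- s') \<cdot>\<^sub>m rank1 m (\<lambda>i. v i t')) *\<^sub>v x)
      = (m / \<eta> + Suc n * d) * (x \<bullet> x) - (\<Sum>i<Suc n. ?s i * (vec m (\<lambda>j. v j (?t i)) \<bullet> x)\<^sup>2)"
      unfolding sum using cM
      by (subst quadratic_form_add_rank1[OF _ x]) (auto simp: forms[OF x] Mx[OF x] algebra_simps)
    show "x \<bullet> ((N - 1\<^sub>m m + s' \<cdot>\<^sub>m rank1 m (\<lambda>i. v i t')) *\<^sub>v x)
      = (m / \<eta> - Suc n) * (x \<bullet> x) + (\<Sum>i<Suc n. ?s i * (vec m (\<lambda>j. v j (?t i)) \<bullet> x)\<^sup>2)"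
      unfolding sum using cN
      by (subst quadratic_form_add_rank1[OF _ x]) (auto simp: forms[OF x] Nx[OF x] algebra_simps)
  qed
qed

text \<open>After \<open>n\<close> steps A lies between the barriers l \<ge> n (1 - \<eta>) and u
  \<le> n (1 + 5 \<eta>); dividing the weights by n (1 - \<eta>) gives the claim. The constant 144
  is 12^2, from \<eta> = \<epsilon> / 12.\<close>

lemma orthonormal_sparsification:
  fixes v :: "nat \<Rightarrow> 'a \<Rightarrow> real"
  assumes int: "\<And>i j. i < m \<Longrightarrow> j < m \<Longrightarrow> integrable \<mu> (\<lambda>t. v i t * v j t)"
    and orth: "\<And>i j. i < m \<Longrightarrow> j < m \<Longrightarrow> (\<integral>t. v i t * v j t \<partial>\<mu>) = (if i = j then 1 else 0)"
    and good: "AE t in \<mu>. good t" and m: "0 < m"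
    and eps: "0 < \<epsilon>" "\<epsilon> < 1" and n: "144 * m / \<epsilon>\<^sup>2 \<le> real n"
  obtains s t where "\<And>i. i < n \<Longrightarrow> 0 < s i" "\<And>i. i < n \<Longrightarrow> good (t i)"
    "\<And>a. (\<Sum>j<m. (a j)\<^sup>2) \<le> (\<Sum>i<n. s i * (\<Sum>j<m. a j * v j (t i))\<^sup>2)"
    "\<And>a. (\<Sum>i<n. s i * (\<Sum>j<m. a j * v j (t i))\<^sup>2) \<le> (1 + \<epsilon>) * (\<Sum>j<m. (a j)\<^sup>2)"
proof -
  define \<eta> where "\<eta> = \<epsilon> / 12"
  \<comment> \<open>The upper barrier moves only slightly faster than the lower one. Since (1 - 2
    \<eta>) (1 + 4 \<eta>) > 1 for small \<eta>, this speed satisfies the condition of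
    \<open>barrier_step\<close>.\<close>
  define d where "d = 1 + 4 * \<eta>"
  have eta: "0 < \<eta>" "\<eta> < 1 / 12" using eps by (auto simp: \<eta>_def)
  then have eta1: "\<eta> < 1" by simp
  have d: "0 < d" using eta by (simp add: d_def)
  have "1 < (1 - 2 * \<eta>) * d"
  proof -
    have "\<eta> * \<eta> < \<eta> * (1 / 12)" using eta by (intro mult_strict_left_mono) auto
    then show ?thesis using eta by (simp add: d_def algebra_simps)
  qed
  then have d2: "1 / d + 2 * \<eta> < 1" using d by (simp add: field_simps)
  \<comment> \<open>The assumption on \<open>n\<close> is n \<ge> m / \<eta>^2; it makes the initial
    offset of the barriers at most \<eta> n.\<close>
  have mn: "m / \<eta> \<le> \<eta> * n"
    using n eta eps by (simp add: \<eta>_def field_simps power2_eq_square)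
  have "0 < 144 * m / \<epsilon>\<^sup>2" using m eps by simp
  then have n0: "0 < real n" using n by linarith
  obtain M N s t where M: "potential_le m \<eta> M" and N: "potential_le m \<eta> N"
    and st: "\<And>i. i < n \<Longrightarrow> 0 < s i \<and> good (t i)"
    and MN: "barrier_forms m \<eta> d v n s t M N"
    using barrier_iteration[OF int orth good m d eta(1) eta1 d2, of n] by blast
  note Mx = barrier_formsD(1)[OF MN] and Nx = barrier_formsD(2)[OF MN]
  define r where "r = n * (1 - \<eta>)"
  have r: "0 < r" using n0 eta by (simp add: r_def)
  define S where "S a = (\<Sum>i<n. s i * (\<Sum>j<m. a j * v j (t i))\<^sup>2)" for a
  have lower: "r * (\<Sum>j<m. (a j)\<^sup>2) \<le> S a" and upper: "S a \<le> n * (1 + 5 * \<eta>) * (\<Sum>j<m. (a j)\<^sup>2)" for a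
  proof -
    define x where "x = vec m a"
    have x: "x \<in> carrier_vec m" by (simp add: x_def)
    have xx: "x \<bullet> x = (\<Sum>j<m. (a j)\<^sup>2)"
      by (simp add: x_def scalar_prod_def atLeast0LessThan power2_eq_square)
    have nn: "0 \<le> (\<Sum>j<m. (a j)\<^sup>2)" by (simp add: sum_nonneg)
    have Sa: "(\<Sum>i<n. s i * (vec m (\<lambda>j. v j (t i)) \<bullet> x)\<^sup>2) = S a"
      by (simp add: S_def x_def scalar_prod_def atLeast0LessThan mult.commute)
    have "0 \<le> x \<bullet> (M *\<^sub>v x)" "0 \<le> x \<bullet> (N *\<^sub>v x)"
      using M N x by (auto simp: potential_le_def intro: spd_nonneg)
    then have *: "S a \<le> (m / \<eta> + n * d) * (\<Sum>j<m. (a j)\<^sup>2)"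
      "(n - m / \<eta>) * (\<Sum>j<m. (a j)\<^sup>2) \<le> S a"
      by (simp_all add: Mx[OF x] Nx[OF x] Sa xx algebra_simps)
    have "(m / \<eta> + n * d) * (\<Sum>j<m. (a j)\<^sup>2) \<le> n * (1 + 5 * \<eta>) * (\<Sum>j<m. (a j)\<^sup>2)"
      using mn by (intro mult_right_mono nn) (simp add: d_def algebra_simps)
    with * show "S a \<le> n * (1 + 5 * \<eta>) * (\<Sum>j<m. (a j)\<^sup>2)" by linarith
    have "r * (\<Sum>j<m. (a j)\<^sup>2) \<le> (n - m / \<eta>) * (\<Sum>j<m. (a j)\<^sup>2)"
      using mn by (intro mult_right_mono nn) (simp add: r_def algebra_simps)
    with * show "r * (\<Sum>j<m. (a j)\<^sup>2) \<le> S a" by linarith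
  qed
  \<comment> \<open>The quotient (1 + 5 \<eta>) / (1 - \<eta>) of the final barriers is at most 1 +
    12 \<eta>, that is 1 + \<epsilon>.\<close>
  have ratio: "n * (1 + 5 * \<eta>) \<le> r * (1 + \<epsilon>)"
  proof -
    have "\<eta> * \<eta> \<le> \<eta> * (1 / 12)" using eta by (intro mult_left_mono) auto
    then have "1 + 5 * \<eta> \<le> (1 - \<eta>) * (1 + 12 * \<eta>)" using eta by (simp add: algebra_simps)
    then show ?thesis using n0 by (simp add: r_def \<eta>_def mult.assoc)
  qed
  have scaled: "(\<Sum>i<n. s i / r * (\<Sum>j<m. a j * v j (t i))\<^sup>2) = S a / r" for a
    by (simp add: S_def sum_divide_distrib)
  show thesis
  proof (rule that)
    show "0 < s i / r" "good (t i)" if "i < n" for i using st[OF that] r by auto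
    fix a
    show "(\<Sum>j<m. (a j)\<^sup>2) \<le> (\<Sum>i<n. s i / r * (\<Sum>j<m. a j * v j (t i))\<^sup>2)"
      unfolding scaled using lower[of a] r by (simp add: field_simps)
    have "S a \<le> n * (1 + 5 * \<eta>) * (\<Sum>j<m. (a j)\<^sup>2)" by (rule upper)
    also have "\<dots> \<le> r * (1 + \<epsilon>) * (\<Sum>j<m. (a j)\<^sup>2)"
      by (intro mult_right_mono ratio sum_nonneg) simp
    finally show "(\<Sum>i<n. s i / r * (\<Sum>j<m. a j * v j (t i))\<^sup>2) \<le> (1 + \<epsilon>) * (\<Sum>j<m. (a j)\<^sup>2)"
      unfolding scaled using r by (simp add: field_simps)
  qed
qed

section \<open>Orthonormal families of square integrable functions\<close>

definition square_integrable :: "'a measure \<Rightarrow> ('a \<Rightarrow> real) \<Rightarrow> bool" where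
  "square_integrable M f \<longleftrightarrow> f \<in> borel_measurable M \<and> integrable M (\<lambda>t. (f t)\<^sup>2)"

lemma square_integrable_mult:
  assumes "square_integrable M f" "square_integrable M g"
  shows "integrable M (\<lambda>t. f t * g t)"
proof (rule Bochner_Integration.integrable_bound)
  show "integrable M (\<lambda>t. (f t)\<^sup>2 + (g t)\<^sup>2)"
    using assms by (auto simp: square_integrable_def)
  show "(\<lambda>t. f t * g t) \<in> borel_measurable M"
    using assms by (auto simp: square_integrable_def)
  have "\<bar>x * y\<bar> \<le> x\<^sup>2 + y\<^sup>2" for x y :: real
    using sum_squares_bound[of "\<bar>x\<bar>" "\<bar>y\<bar>"] mult_nonneg_nonneg[of "\<bar>x\<bar>" "\<bar>y\<bar>"]
    by (simp only: abs_mult power2_abs) linarith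
  then show "AE t in M. norm (f t * g t) \<le> norm ((f t)\<^sup>2 + (g t)\<^sup>2)"
    by (intro AE_I2) (simp add: order_trans[OF _ abs_ge_self])
qed

lemma square_integrable_scale:
  "square_integrable M f \<Longrightarrow> square_integrable M (\<lambda>t. c * f t)"
  by (auto simp: square_integrable_def power_mult_distrib)

lemma square_integrable_add:
  assumes "square_integrable M f" "square_integrable M g"
  shows "square_integrable M (\<lambda>t. f t + g t)"
  using assms square_integrable_mult[OF assms]
  by (auto simp: square_integrable_def power2_sum intro!: Bochner_Integration.integrable_add)
    (simp add: mult.assoc)

lemma square_integrable_sum:
  assumes "finite I" "\<And>i. i \<in> I \<Longrightarrow> square_integrable M (f i)"
  shows "square_integrable M (\<lambda>t. \<Sum>i\<in>I. f i t)"
  using assms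
  by (induction I rule: finite_induct) (auto simp: square_integrable_add, simp add: square_integrable_def)

lemma square_linear_combination_measurable:
  assumes "finite J" "\<And>j. j \<in> J \<Longrightarrow> square_integrable M (F j)"
  shows "(\<lambda>t. (\<Sum>j\<in>J. a j * F j t)\<^sup>2) \<in> borel_measurable M"
proof -
  have "square_integrable M (\<lambda>t. \<Sum>j\<in>J. a j * F j t)"
    by (intro square_integrable_sum square_integrable_scale assms)
  then show ?thesis unfolding square_integrable_def by (intro borel_measurable_power) auto
qed

definition orthonormal_family :: "'a measure \<Rightarrow> nat \<Rightarrow> (nat \<Rightarrow> 'a \<Rightarrow> real) \<Rightarrow> bool" where
  "orthonormal_family M m v \<longleftrightarrow> (\<forall>i<m. square_integrable M (v i)) \<and>
     (\<forall>i<m. \<forall>j<m. (\<integral>t. v i t * v j t \<partial>M) = (if i = j then 1 else 0))"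

lemma orthonormal_family_square_integrable:
  "orthonormal_family M m v \<Longrightarrow> i < m \<Longrightarrow> square_integrable M (v i)"
  by (simp add: orthonormal_family_def)

lemma orthonormal_family_integral:
  "orthonormal_family M m v \<Longrightarrow> i < m \<Longrightarrow> j < m \<Longrightarrow>
     (\<integral>t. v i t * v j t \<partial>M) = (if i = j then 1 else 0)"
  by (simp add: orthonormal_family_def)

lemma parseval:
  assumes v: "orthonormal_family M m v"
  shows "(\<integral>t. (\<Sum>i<m. a i * v i t)\<^sup>2 \<partial>M) = (\<Sum>i<m. (a i)\<^sup>2)"
proof -
  have int: "integrable M (\<lambda>t. v i t * v j t)" if "i < m" "j < m" for i j
    using square_integrable_mult orthonormal_family_square_integrable[OF v] that by blast
  have "(\<integral>t. (\<Sum>i<m. a i * v i t)\<^sup>2 \<partial>M) = (\<integral>t. (\<Sum>i<m. \<Sum>j<m. (a i * a j) * (v i t * v j t)) \<partial>M)"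
    by (simp add: power2_eq_square sum_product mult_ac)
  also have "\<dots> = (\<Sum>i<m. \<Sum>j<m. (a i * a j) * (\<integral>t. v i t * v j t \<partial>M))"
    using int by (subst Bochner_Integration.integral_sum; (intro Bochner_Integration.integrable_sum)?; simp)+
  also have "\<dots> = (\<Sum>i<m. \<Sum>j<m. if j = i then (a i)\<^sup>2 else 0)"
    by (intro sum.cong) (auto simp: orthonormal_family_integral[OF v] power2_eq_square)
  finally show ?thesis by simp
qed

text \<open>Gram-Schmidt without assuming independence: a function whose residual has norm zero adds
  no vector, hence m \<le> card J. The expansions hold almost everywhere because a residual of norm
  zero vanishes only almost everywhere.\<close>

lemma gram_schmidt:
  assumes "finite J" "\<And>j. j \<in> J \<Longrightarrow> square_integrable M (F j)"
  shows "\<exists>m v C. m \<le> card J \<and> orthonormal_family M m v \<and>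
           (\<forall>j\<in>J. AE t in M. F j t = (\<Sum>i<m. C j i * v i t))"
  using assms
proof (induction J rule: finite_induct)
  case empty
  show ?case by (rule exI[of _ 0]) (auto simp: orthonormal_family_def)
next
  case (insert j0 J)
  have "\<And>j. j \<in> J \<Longrightarrow> square_integrable M (F j)" using insert.prems by simp
  from insert.IH[OF this] obtain m v C where m: "m \<le> card J" and v: "orthonormal_family M m v"
    and C: "\<And>j. j \<in> J \<Longrightarrow> AE t in M. F j t = (\<Sum>i<m. C j i * v i t)"
    by blast
  note si = orthonormal_family_square_integrable[OF v]
  have f: "square_integrable M (F j0)" using insert.prems by simp
  define c where "c i = (\<integral>t. F j0 t * v i t \<partial>M)" for i
  define g where "g t = F j0 t - (\<Sum>i<m. c i * v i t)" for t
  have g: "square_integrable M g"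
    using square_integrable_add[OF f square_integrable_scale[of M _ "-1"],
        OF square_integrable_sum[of "{..<m}" M "\<lambda>i t. c i * v i t"]] si
    by (simp add: g_def[abs_def] square_integrable_scale)
  have gv: "(\<integral>t. g t * v i t \<partial>M) = 0" if i: "i < m" for i
  proof -
    have "(\<integral>t. g t * v i t \<partial>M) = (\<integral>t. F j0 t * v i t - (\<Sum>l<m. c l * (v l t * v i t)) \<partial>M)"
      by (simp add: g_def left_diff_distrib sum_distrib_right mult.assoc)
    also have "\<dots> = c i - (\<Sum>l<m. c l * (\<integral>t. v l t * v i t \<partial>M))"
      using square_integrable_mult[OF f si[OF i]] square_integrable_mult[OF si si[OF i]]
        Bochner_Integration.integrable_sum[of "{..<m}" M "\<lambda>l t. c l * (v l t * v i t)"]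
      by (simp add: c_def[of i])
    also have "(\<Sum>l<m. c l * (\<integral>t. v l t * v i t \<partial>M)) = (\<Sum>l<m. if l = i then c i else 0)"
      using i by (intro sum.cong) (auto simp: orthonormal_family_integral[OF v])
    finally show ?thesis using i by simp
  qed
  define \<gamma> where "\<gamma> = (\<integral>t. (g t)\<^sup>2 \<partial>M)"
  have gamma: "0 \<le> \<gamma>" by (simp add: \<gamma>_def)
  show ?case
  proof (cases "\<gamma> = 0")
    case True
    then have "AE t in M. (g t)\<^sup>2 = 0"
      using g by (subst (asm) \<gamma>_def, subst (asm) integral_nonneg_eq_0_iff_AE)
        (auto simp: square_integrable_def)
    then have "AE t in M. F j0 t = (\<Sum>i<m. c i * v i t)"
      by eventually_elim (simp add: g_def)
    then show ?thesis
      using m v C insert.hyps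
      by (intro exI[of _ m] exI[of _ v] exI[of _ "C(j0 := c)"]) (auto simp: card_insert_if)
  next
    case False
    with gamma have gpos: "0 < \<gamma>" by simp
    define w where "w = v(m := (\<lambda>t. (1 / sqrt \<gamma>) * g t))"
    \<comment> \<open>The new vector has coefficient 0 in the earlier functions and
      \<open>sqrt \<gamma>\<close>, the norm of the residual, in \<open>F j0\<close>.\<close>
    define C' where "C' = (\<lambda>j. (C j)(m := 0))(j0 := c(m := sqrt \<gamma>))"
    have "(\<integral>t. w m t * w m t \<partial>M) = (\<integral>t. (1 / \<gamma>) * (g t)\<^sup>2 \<partial>M)"
      using gpos by (intro Bochner_Integration.integral_cong) (auto simp: w_def power2_eq_square)
    also have "\<dots> = 1" using gpos by (simp add: \<gamma>_def[symmetric])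
    finally have wm: "(\<integral>t. w m t * w m t \<partial>M) = 1" .
    have wi: "(\<integral>t. w m t * w i t \<partial>M) = 0" if "i < m" for i
    proof -
      have "(\<integral>t. w m t * w i t \<partial>M) = (\<integral>t. (1 / sqrt \<gamma>) * (g t * v i t) \<partial>M)"
        using that by (intro Bochner_Integration.integral_cong) (auto simp: w_def)
      then show ?thesis by (simp add: gv[OF that])
    qed
    have "orthonormal_family M (Suc m) w"
      unfolding orthonormal_family_def
    proof (intro conjI allI impI)
      show "square_integrable M (w i)" if "i < Suc m" for i
        using that si square_integrable_scale[OF g, of "1 / sqrt \<gamma>"] by (auto simp: w_def)
      fix i j assume "i < Suc m" "j < Suc m"
      then consider "i < m" "j < m" | "i = m" "j < m" | "i < m" "j = m" | "i = m" "j = m"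
        by linarith
      then show "(\<integral>t. w i t * w j t \<partial>M) = (if i = j then 1 else 0)"
      proof cases
        case 1
        then show ?thesis using orthonormal_family_integral[OF v] by (simp add: w_def)
      next
        case 3
        then show ?thesis using wi[of i] by (simp add: mult.commute)
      qed (use wm wi in auto)
    qed
    moreover have "AE t in M. F j t = (\<Sum>i<Suc m. C' j i * w i t)" if j: "j \<in> insert j0 J" for j
    proof (cases "j = j0")
      case True
      then show ?thesis using gpos by (simp add: C'_def w_def g_def)
    next
      case False
      with j have "AE t in M. F j t = (\<Sum>i<m. C j i * v i t)" using C by simp
      then show ?thesis using False by (simp add: C'_def w_def)
    qed
    ultimately show ?thesis using m insert.hyps
      by (intro exI[of _ "Suc m"] exI[of _ w] exI[of _ C']) auto
  qed
qed

section \<open>Monomials of fixed degree\<close>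

text \<open>Exponent vectors are lists of fixed length and sum, so that
  \<open>card_length_sum_list\<close> counts them by a binomial coefficient.\<close>

definition exponents :: "nat \<Rightarrow> nat \<Rightarrow> nat list set" where
  "exponents k q = {l. length l = k \<and> sum_list l = q}"

definition monomial :: "nat \<Rightarrow> (nat \<Rightarrow> real) \<Rightarrow> nat list \<Rightarrow> real" where
  "monomial k y l = (\<Prod>j<k. y j ^ (l ! j))"

lemma finite_exponents: "finite (exponents k q)"
proof (rule finite_subset)
  show "exponents k q \<subseteq> {l. set l \<subseteq> {..q} \<and> length l = k}"
    by (auto simp: exponents_def member_le_sum_list)
  show "finite {l. set l \<subseteq> {..q} \<and> length l = k}" by (rule finite_lists_length_eq) simp
qed

text \<open>The multinomial theorem with unspecified coefficients. It matters that \<open>a\<close>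
  depends on \<open>c\<close> alone: the same coefficients serve at every point of the
  domain.\<close>

lemma power_linear_combination:
  "\<exists>a. \<forall>y. (\<Sum>j<k. c j * y j) ^ q = (\<Sum>l\<in>exponents k q. a l * monomial k y l)"
proof (induction q)
  case 0
  have "exponents k 0 = {replicate k 0}"
    by (auto simp: exponents_def list_eq_iff_nth_eq sum_list_eq_0_iff)
  then show ?case by (intro exI[of _ "\<lambda>_. 1"]) (simp add: monomial_def)
next
  case (Suc q)
  then obtain a where a: "\<And>y. (\<Sum>j<k. c j * y j) ^ q = (\<Sum>l\<in>exponents k q. a l * monomial k y l)"
    by blast
  define h where "h = (\<lambda>(l, j). l[j := Suc (l ! j)] :: nat list)"
  define D where "D = exponents k q \<times> {..<k}"
  \<comment> \<open>Multiplying by the variable \<open>j\<close> raises the exponent at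
    \<open>j\<close>, which is the map \<open>h\<close>. Different pairs can reach the same
    exponent, so \<open>a'\<close> collects their contributions.\<close>
  define a' where "a' l' = (\<Sum>(l, j) | (l, j) \<in> D \<and> h (l, j) = l'. a l * c j)" for l'
  have hD: "h ` D \<subseteq> exponents k (Suc q)"
    by (auto simp: h_def D_def exponents_def sum_list_update member_le_sum_list)
  have finD: "finite D" by (simp add: D_def finite_exponents)
  have mono: "monomial k y l * y j = monomial k y (h (l, j))" if "(l, j) \<in> D" for y l j
  proof -
    have j: "j < k" "length l = k" using that by (auto simp: D_def exponents_def)
    have "monomial k y (h (l, j)) = y j ^ Suc (l ! j) * (\<Prod>i\<in>{..<k} - {j}. y i ^ (l ! i))"
      unfolding monomial_def h_def using j by (subst prod.remove[of _ j]) (auto intro!: prod.cong)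
    moreover have "monomial k y l = y j ^ (l ! j) * (\<Prod>i\<in>{..<k} - {j}. y i ^ (l ! i))"
      unfolding monomial_def using j by (subst prod.remove[of _ j]) auto
    ultimately show ?thesis by simp
  qed
  have "(\<Sum>j<k. c j * y j) ^ Suc q = (\<Sum>l'\<in>exponents k (Suc q). a' l' * monomial k y l')" for y
  proof -
    have "(\<Sum>j<k. c j * y j) ^ Suc q = (\<Sum>(l, j)\<in>D. (a l * c j) * monomial k y (h (l, j)))"
      unfolding power_Suc2 a sum_product sum.cartesian_product D_def
      by (intro sum.cong) (auto simp: mono[symmetric] D_def)
    also have "\<dots> = (\<Sum>l'\<in>exponents k (Suc q). \<Sum>z\<in>{z\<in>D. h z = l'}.
        (case z of (l, j) \<Rightarrow> (a l * c j) * monomial k y (h (l, j))))"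
      by (rule sum.group[symmetric, OF finD finite_exponents hD])
    also have "\<dots> = (\<Sum>l'\<in>exponents k (Suc q). a' l' * monomial k y l')"
      unfolding a'_def sum_distrib_right by (intro sum.cong) auto
    finally show ?thesis .
  qed
  then show ?case by blast
qed

text \<open>With A the largest absolute value of a coordinate, the monomial is at most A^q in
  absolute value, and A^(2q) is one of the summands. Thus monomials in functions from $L_p$ are
  square integrable.\<close>

lemma monomial_square_le:
  assumes l: "l \<in> exponents k q" and q: "0 < q"
  shows "(monomial k y l)\<^sup>2 \<le> (\<Sum>j<k. (y j) ^ (2 * q))"
proof -
  have len: "length l = k" and sum: "(\<Sum>j<k. l ! j) = q"
    using l by (auto simp: exponents_def sum_list_sum_nth atLeast0LessThan)
  have k: "{..<k} \<noteq> {}" using sum q by (cases k) auto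
  define A where "A = Max ((\<lambda>j. \<bar>y j\<bar>) ` {..<k})"
  have A: "\<bar>y j\<bar> \<le> A" if "j < k" for j unfolding A_def using that by (intro Max_ge) auto
  have "A \<in> (\<lambda>j. \<bar>y j\<bar>) ` {..<k}" unfolding A_def using k by (intro Max_in) auto
  then obtain j0 where j0: "j0 < k" "A = \<bar>y j0\<bar>" by auto
  have "\<bar>monomial k y l\<bar> = (\<Prod>j<k. \<bar>y j\<bar> ^ (l ! j))"
    by (simp add: monomial_def abs_prod power_abs)
  also have "\<dots> \<le> (\<Prod>j<k. A ^ (l ! j))"
    by (intro prod_mono conjI power_mono A) auto
  also have "\<dots> = A ^ q" by (simp add: sum power_sum[symmetric])
  finally have "\<bar>monomial k y l\<bar>\<^sup>2 \<le> (A ^ q)\<^sup>2" by (intro power_mono) auto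
  also have "\<dots> = \<bar>y j0\<bar> ^ (2 * q)" by (simp add: j0(2) mult.commute flip: power_mult)
  also have "\<dots> = (y j0) ^ (2 * q)" by (simp add: power_even_abs)
  also have "\<dots> \<le> (\<Sum>j<k. (y j) ^ (2 * q))"
    using j0(1) by (intro member_le_sum[where f = "\<lambda>j. y j ^ (2 * q)"]) auto
  finally show ?thesis by simp
qed

text \<open>The count is (q + k - 1 choose q) \<le> (q + k - 1)^q / q!. Here q + k - 1 \<le> 3 k /
  2, and q! \<ge> (q / e)^q because q^q / q! is one term of the series of e^q. Finally 3 e / 2 <
  5.\<close>

lemma card_exponents_le:
  assumes q: "0 < q" and k: "2 * q \<le> k"
  shows "real (card (exponents k q)) \<le> (5 * real k / real q) ^ q"
proof -
  have "real (card (exponents k q)) = real ((q + k - 1) choose q)"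
    by (simp add: exponents_def card_length_sum_list)
  also have "\<dots> \<le> real (q + k - 1) ^ q / fact q"
    using of_nat_mono[OF binomial_fact_pow[of "q + k - 1" q], where ?'a = real]
    by (simp add: field_simps)
  also have "\<dots> \<le> (3 / 2 * real k) ^ q / fact q"
    using k q by (intro divide_right_mono power_mono) auto
  also have "\<dots> \<le> (3 / 2 * real k) ^ q * (exp 1 / real q) ^ q"
  proof -
    have "real q ^ q / fact q \<le> exp (real q)"
    proof -
      have "(\<Sum>i\<in>{q}. real q ^ i / fact i) \<le> (\<Sum>i. real q ^ i / fact i)"
        using summable_exp[of "real q"]
        by (intro sum_le_suminf) (auto simp: divide_inverse mult.commute)
      then show ?thesis by (simp add: exp_def divide_inverse mult.commute scaleR_conv_of_real)
    qed
    then have "1 / fact q \<le> (exp 1 / real q) ^ q"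
      using q by (simp add: field_simps power_divide exp_of_nat_mult[symmetric])
    then show ?thesis
      using mult_left_mono[of "1 / fact q" "(exp 1 / real q) ^ q" "(3 / 2 * real k) ^ q"] by simp
  qed
  also have "\<dots> = (3 / 2 * exp 1 * (real k / real q)) ^ q"
    by (simp add: power_mult_distrib[symmetric] mult_ac)
  also have "\<dots> \<le> (5 * (real k / real q)) ^ q"
    using e_less_272 by (intro power_mono mult_right_mono) auto
  finally show ?thesis by simp
qed

section \<open>Representatives of almost everywhere classes\<close>

lemma l0_rep_abs:
  assumes "f \<in> borel_measurable leb01"
  shows "ae_eq01 (rep_l0 (abs_l0 f)) f"
  using assms by (intro Quotient3_rep_abs[OF Quotient3_l0]) (simp add: ae_eq01_def)

lemma l0_rep_measurable [measurable]: "rep_l0 x \<in> borel_measurable leb01"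
  using Quotient3_rep_reflp[OF Quotient3_l0, of x] by (simp add: ae_eq01_def)

lemma rep_l0_zero: "AE t in leb01. rep_l0 0 t = 0"
  using l0_rep_abs[of "\<lambda>_. 0"] by (simp add: zero_l0_def ae_eq01_def)

lemma rep_l0_add: "AE t in leb01. rep_l0 (x + y) t = rep_l0 x t + rep_l0 y t"
proof -
  have "x + y = abs_l0 (\<lambda>t. rep_l0 x t + rep_l0 y t)"
    by (simp add: plus_l0_def)
  then show ?thesis using l0_rep_abs[of "\<lambda>t. rep_l0 x t + rep_l0 y t"] by (simp add: ae_eq01_def)
qed

lemma rep_l0_scaleR: "AE t in leb01. rep_l0 (c *\<^sub>R x) t = c * rep_l0 x t"
proof -
  have "c *\<^sub>R x = abs_l0 (\<lambda>t. c * rep_l0 x t)"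
    by (simp add: scaleR_l0_def)
  then show ?thesis using l0_rep_abs[of "\<lambda>t. c * rep_l0 x t"] by (simp add: ae_eq01_def)
qed

lemma rep_l0_linear_combination:
  assumes "finite I"
  shows "AE t in leb01. rep_l0 (\<Sum>i\<in>I. c i *\<^sub>R b i) t = (\<Sum>i\<in>I. c i * rep_l0 (b i) t)"
  using assms
proof (induction I rule: finite_induct)
  case empty
  then show ?case using rep_l0_zero by simp
next
  case (insert i I)
  show ?case
    using insert.IH rep_l0_add[of "c i *\<^sub>R b i" "\<Sum>i\<in>I. c i *\<^sub>R b i"] rep_l0_scaleR[of "c i" "b i"]
    by eventually_elim (use insert.hyps in simp)
qed

text \<open>Evenness of the exponent enters here: the integrand of the norm becomes a polynomial.
  For \<open>q = 0\<close> the equation fails at 0, where \<open>powr\<close> gives 0.\<close>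

lemma abs_powr_even: "0 < q \<Longrightarrow> \<bar>x\<bar> powr real (2 * q) = x ^ (2 * q)"
  using powr_realpow'[of "\<bar>x\<bar>" "2 * q"] by (simp add: power_even_abs)

section \<open>Discretisation of the norm\<close>

text \<open>The sparsification is applied to an orthonormal family spanning the \<open>F j\<close>
  and transported back through the coefficients. One choice of points and weights serves all
  \<open>a\<close>.\<close>

lemma square_integrable_sparsification:
  fixes F :: "'j \<Rightarrow> 'a \<Rightarrow> real"
  assumes J: "finite J" and F: "\<And>j. j \<in> J \<Longrightarrow> square_integrable M (F j)"
    and M: "emeasure M (space M) \<noteq> 0"
    and eps: "0 < \<epsilon>" "\<epsilon> < 1" and n: "144 * real (card J) / \<epsilon>\<^sup>2 \<le> real n"
  obtains s t where "\<And>i. i < n \<Longrightarrow> 0 < s i"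
    "\<And>a. (\<integral>t. (\<Sum>j\<in>J. a j * F j t)\<^sup>2 \<partial>M) \<le> (\<Sum>i<n. s i * (\<Sum>j\<in>J. a j * F j (t i))\<^sup>2)"
    "\<And>a. (\<Sum>i<n. s i * (\<Sum>j\<in>J. a j * F j (t i))\<^sup>2) \<le> (1 + \<epsilon>) * (\<integral>t. (\<Sum>j\<in>J. a j * F j t)\<^sup>2 \<partial>M)"
proof -
  obtain m v C where m: "m \<le> card J" and v: "orthonormal_family M m v"
    and C: "\<And>j. j \<in> J \<Longrightarrow> AE t in M. F j t = (\<Sum>i<m. C j i * v i t)"
    using gram_schmidt[OF J, of M F] F by blast
  \<comment> \<open>Sampling needs pointwise identities, whereas the expansions hold almost
    everywhere. As \<open>J\<close> is finite, almost every point satisfies all of them.\<close>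
  define good where "good t \<longleftrightarrow> (\<forall>j\<in>J. F j t = (\<Sum>i<m. C j i * v i t))" for t
  have good: "AE t in M. good t"
    unfolding good_def by (intro AE_finite_allI J C)
  define \<beta> where "\<beta> a i = (\<Sum>j\<in>J. a j * C j i)" for a i
  have comb: "(\<Sum>j\<in>J. a j * F j t) = (\<Sum>i<m. \<beta> a i * v i t)" if "good t" for a t
  proof -
    have "(\<Sum>j\<in>J. a j * F j t) = (\<Sum>j\<in>J. \<Sum>i<m. a j * C j i * v i t)"
      using that by (intro sum.cong) (auto simp: good_def sum_distrib_left mult.assoc)
    also have "\<dots> = (\<Sum>i<m. \<beta> a i * v i t)"
      by (subst sum.swap) (simp add: \<beta>_def sum_distrib_right)
    finally show ?thesis .
  qed
  have norm: "(\<integral>t. (\<Sum>j\<in>J. a j * F j t)\<^sup>2 \<partial>M) = (\<Sum>i<m. (\<beta> a i)\<^sup>2)" for a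
  proof -
    have "(\<integral>t. (\<Sum>j\<in>J. a j * F j t)\<^sup>2 \<partial>M) = (\<integral>t. (\<Sum>i<m. \<beta> a i * v i t)\<^sup>2 \<partial>M)"
    proof (intro integral_cong_AE)
      show "(\<lambda>t. (\<Sum>j\<in>J. a j * F j t)\<^sup>2) \<in> borel_measurable M"
        by (rule square_linear_combination_measurable[OF J F])
      show "(\<lambda>t. (\<Sum>i<m. \<beta> a i * v i t)\<^sup>2) \<in> borel_measurable M"
        by (rule square_linear_combination_measurable)
          (simp_all add: orthonormal_family_square_integrable[OF v])
      show "AE t in M. (\<Sum>j\<in>J. a j * F j t)\<^sup>2 = (\<Sum>i<m. \<beta> a i * v i t)\<^sup>2"
        using good by eventually_elim (simp add: comb)
    qed
    then show ?thesis by (simp add: parseval[OF v])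
  qed
  show thesis
  proof (cases "m = 0")
    \<comment> \<open>All combinations vanish almost everywhere, and the barrier argument needs m >
      0. Any good point with weight 1 works; one exists because the measure is nonzero.\<close>
    case True
    have "\<exists>t. good t"
    proof (rule ccontr)
      assume "\<nexists>t. good t"
      then have "AE t in M. False" using good by simp
      then show False using M by (simp add: AE_iff_null null_sets_def)
    qed
    then obtain t where "good t" by blast
    then have "(\<Sum>j\<in>J. a j * F j t) = 0" for a using True by (simp add: comb)
    with that[of "\<lambda>_. 1" "\<lambda>_. t"] True show thesis by (simp add: norm)
  next
    case False
    have int: "integrable M (\<lambda>t. v i t * v j t)" if "i < m" "j < m" for i j
      using square_integrable_mult orthonormal_family_square_integrable[OF v] that by blast
    have "144 * real m / \<epsilon>\<^sup>2 \<le> 144 * real (card J) / \<epsilon>\<^sup>2"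
      using m by (intro divide_right_mono) auto
    with n have n': "144 * real m / \<epsilon>\<^sup>2 \<le> real n" by linarith
    have m0: "0 < m" using False by simp
    obtain s t where s: "\<And>i. i < n \<Longrightarrow> 0 < s i" and t: "\<And>i. i < n \<Longrightarrow> good (t i)"
      and bounds: "\<And>a. (\<Sum>j<m. (a j)\<^sup>2) \<le> (\<Sum>i<n. s i * (\<Sum>j<m. a j * v j (t i))\<^sup>2)"
      "\<And>a. (\<Sum>i<n. s i * (\<Sum>j<m. a j * v j (t i))\<^sup>2) \<le> (1 + \<epsilon>) * (\<Sum>j<m. (a j)\<^sup>2)"
      by (rule orthonormal_sparsification[OF int orthonormal_family_integral[OF v] good m0 eps n'])
        blast+
    have "(\<Sum>i<n. s i * (\<Sum>j\<in>J. a j * F j (t i))\<^sup>2) = (\<Sum>i<n. s i * (\<Sum>j<m. \<beta> a j * v j (t i))\<^sup>2)" for a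
      using t by (intro sum.cong) (auto simp: comb)
    with bounds show thesis by (intro that[of s t] s) (simp_all add: norm)
  qed
qed

text \<open>The sparsification is applied to the monomials of degree \<open>q\<close> in a basis of
  \<open>X\<close>. Since x^q is a combination of them, the weighted sum of x(t)^(2q) over the
  sampled points approximates the p-th power of the norm of x.\<close>

lemma even_Lp_embedding:
  assumes q: "0 < q" and k: "0 < k"
    and X: "subspace X" "X \<subseteq> Lp (real (2 * q))" "dim X = k"
    and eps: "0 < \<epsilon>" "\<epsilon> < 1" and n: "144 * real (card (exponents k q)) / \<epsilon>\<^sup>2 \<le> real n"
  shows "embeds_lp X (Lp_norm (real (2 * q))) \<epsilon> (real (2 * q)) n"
proof -
  obtain B where B: "B \<subseteq> X" "independent B" "X \<subseteq> span B" "card B = k"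
    using basis_exists[of X] X(3) by blast
  \<comment> \<open>Infinite sets have \<open>card\<close> 0, so a positive \<open>k\<close> forces
    finiteness.\<close>
  have finB: "finite B" using B(4) k by (intro card_ge_0_finite) simp
  obtain b where b: "bij_betw b {..<k} B"
    using ex_bij_betw_nat_finite[OF finB] B(4) by (auto simp: atLeast0LessThan)
  define f where "f j = rep_l0 (b j)" for j
  define c where "c x j = representation B x (b j)" for x j
  have rep: "AE t in leb01. rep_l0 x t = (\<Sum>j<k. c x j * f j t)" if x: "x \<in> X" for x
  proof -
    have "x = (\<Sum>z\<in>B. representation B x z *\<^sub>R z)"
      using sum_representation_eq[OF B(2), of x B] x B(3) finB by auto
    also have "\<dots> = (\<Sum>j<k. c x j *\<^sub>R b j)"
      unfolding c_def by (rule sum.reindex_bij_betw[OF b, symmetric])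
    finally show ?thesis
      using rep_l0_linear_combination[of "{..<k}" "c x" b] by (simp add: f_def)
  qed
  have f_meas: "f j \<in> borel_measurable leb01" for j by (simp add: f_def l0_rep_measurable)
  have f_int: "integrable leb01 (\<lambda>t. f j t ^ (2 * q))" if "j < k" for j
  proof -
    have "b j \<in> Lp (real (2 * q))" using b that B(1) X(2) by (auto simp: bij_betw_def)
    then show ?thesis
      unfolding Lp_def in_Lp.rep_eq mem_Collect_eq abs_powr_even[OF q] f_def .
  qed
  define F where "F l t = monomial k (\<lambda>j. f j t) l" for l t
  have F: "square_integrable leb01 (F l)" if l: "l \<in> exponents k q" for l
  proof -
    have meas: "F l \<in> borel_measurable leb01"
      unfolding F_def monomial_def using f_meas by (intro borel_measurable_prod borel_measurable_power) auto
    moreover have "integrable leb01 (\<lambda>t. (F l t)\<^sup>2)"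
    proof (rule Bochner_Integration.integrable_bound)
      show "integrable leb01 (\<lambda>t. \<Sum>j<k. f j t ^ (2 * q))"
        using f_int by (intro Bochner_Integration.integrable_sum) auto
      show "(\<lambda>t. (F l t)\<^sup>2) \<in> borel_measurable leb01" using meas by simp
      show "AE t in leb01. norm ((F l t)\<^sup>2) \<le> norm (\<Sum>j<k. f j t ^ (2 * q))"
        using monomial_square_le[OF l q] unfolding F_def
        by (intro AE_I2) (simp add: order_trans[OF _ abs_ge_self])
    qed
    ultimately show ?thesis by (simp add: square_integrable_def)
  qed
  have nz: "emeasure leb01 (space leb01) \<noteq> 0"
    by (simp add: emeasure_restrict_space)
  obtain s t where s: "\<And>i. i < n \<Longrightarrow> 0 < s i"
    and lower: "\<And>a. (\<integral>t. (\<Sum>l\<in>exponents k q. a l * F l t)\<^sup>2 \<partial>leb01)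
      \<le> (\<Sum>i<n. s i * (\<Sum>l\<in>exponents k q. a l * F l (t i))\<^sup>2)"
    and upper: "\<And>a. (\<Sum>i<n. s i * (\<Sum>l\<in>exponents k q. a l * F l (t i))\<^sup>2)
      \<le> (1 + \<epsilon>) * (\<integral>t. (\<Sum>l\<in>exponents k q. a l * F l t)\<^sup>2 \<partial>leb01)"
    by (rule square_integrable_sparsification[OF finite_exponents F nz eps n]) blast+
  define p where "p = real (2 * q)"
  have p: "1 \<le> p" using q by (simp add: p_def)
  \<comment> \<open>The map samples x at the points \<open>t i\<close>. Evaluation goes through
    fixed representatives of the basis vectors, which makes it well defined on classes and exactly
    linear; the p-th root of the weight enters because the norm takes p-th powers.\<close>
  define T where "T x i = (if i < n then s i powr (1 / p) * (\<Sum>j<k. c x j * f j (t i)) else 0)" for x i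
  define S where "S x = (\<Sum>i<n. s i * (\<Sum>j<k. c x j * f j (t i)) ^ (2 * q))" for x
  define I where "I x = (\<integral>t. \<bar>rep_l0 x t\<bar> powr p \<partial>leb01)" for x
  have bounds: "I x \<le> S x" "S x \<le> (1 + \<epsilon>) * I x" if x: "x \<in> X" for x
  proof -
    obtain a where a: "\<And>y. (\<Sum>j<k. c x j * y j) ^ q = (\<Sum>l\<in>exponents k q. a l * monomial k y l)"
      using power_linear_combination[of "c x" k q] by blast
    have sq: "(\<Sum>j<k. c x j * f j t) ^ (2 * q) = (\<Sum>l\<in>exponents k q. a l * F l t)\<^sup>2" for t
      unfolding F_def a[symmetric] by (simp add: mult.commute flip: power_mult)
    have "I x = (\<integral>t. (\<Sum>l\<in>exponents k q. a l * F l t)\<^sup>2 \<partial>leb01)"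
      unfolding I_def p_def abs_powr_even[OF q]
    proof (intro integral_cong_AE)
      show "AE t in leb01. rep_l0 x t ^ (2 * q) = (\<Sum>l\<in>exponents k q. a l * F l t)\<^sup>2"
        using rep[OF x] by eventually_elim (simp add: sq)
      show "(\<lambda>t. (\<Sum>l\<in>exponents k q. a l * F l t)\<^sup>2) \<in> borel_measurable leb01"
        by (rule square_linear_combination_measurable[OF finite_exponents F])
    qed measurable
    moreover have "S x = (\<Sum>i<n. s i * (\<Sum>l\<in>exponents k q. a l * F l (t i))\<^sup>2)"
      unfolding S_def sq ..
    ultimately show "I x \<le> S x" "S x \<le> (1 + \<epsilon>) * I x"
      using lower[of a] upper[of a] by simp_all
  qed
  have lpT: "lp_norm p n (T x) = S x powr (1 / p)" for x
  proof -
    have "\<bar>T x i\<bar> powr p = s i * (\<Sum>j<k. c x j * f j (t i)) ^ (2 * q)" if "i < n" for i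
    proof -
      have "\<bar>T x i\<bar> powr p = (s i powr (1 / p)) powr p * \<bar>\<Sum>j<k. c x j * f j (t i)\<bar> powr p"
        using that by (simp add: T_def abs_mult powr_mult)
      also have "\<bar>\<Sum>j<k. c x j * f j (t i)\<bar> powr p = (\<Sum>j<k. c x j * f j (t i)) ^ (2 * q)"
        unfolding p_def by (rule abs_powr_even[OF q])
      also have "(s i powr (1 / p)) powr p = s i" using p s[OF that] by (simp add: powr_powr)
      finally show ?thesis .
    qed
    then show ?thesis by (simp add: lp_norm_def S_def)
  qed
  have Lpx: "Lp_norm p x = I x powr (1 / p)" for x by (simp add: Lp_norm.rep_eq I_def)
  have I0: "0 \<le> I x" for x by (simp add: I_def)
  have "N_le \<and> le_N"
    if x: "x \<in> X" and N_le: "N_le = (Lp_norm p x \<le> lp_norm p n (T x))"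
      and le_N: "le_N = (lp_norm p n (T x) \<le> (1 + \<epsilon>) * Lp_norm p x)" for x N_le le_N
  proof
    show N_le unfolding N_le lpT Lpx using bounds[OF x] I0 p by (intro powr_mono2) auto
    have "S x powr (1 / p) \<le> ((1 + \<epsilon>) * I x) powr (1 / p)"
      using bounds[OF x] I0[of x] p by (intro powr_mono2) auto
    also have "\<dots> = (1 + \<epsilon>) powr (1 / p) * I x powr (1 / p)"
      using eps I0 by (simp add: powr_mult)
    \<comment> \<open>Taking p-th roots only improves the distortion, as 1 / p \<le> 1.\<close>
    also have "\<dots> \<le> (1 + \<epsilon>) powr 1 * I x powr (1 / p)"
      using eps p by (intro mult_right_mono powr_mono) auto
    finally show le_N unfolding le_N lpT Lpx using eps by simp
  qed
  moreover have "T (x + y) i = T x i + T y i" if "x \<in> X" "y \<in> X" for x y i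
    using that B(3)
    by (auto simp: T_def c_def representation_add[OF B(2)] sum.distrib distrib_left distrib_right subset_iff)
  moreover have "T (r *\<^sub>R x) i = r * T x i" if "x \<in> X" for r x i
    using that B(3)
    by (auto simp: T_def c_def representation_scale[OF B(2)] sum_distrib_left mult_ac subset_iff)
  ultimately show ?thesis
    unfolding embeds_lp_def p_def[symmetric] by (intro exI[of _ T]) (auto simp: T_def[abs_def] Rn_def)
qed

section \<open>The two forms of the relation between n and k\<close>

lemma even_Lp_embedding_if_large_n:
  fixes p k n :: nat
  assumes p: "0 < p" "even p" "p \<le> k" and eps: "0 < \<epsilon>" "\<epsilon> < 1"
    and X: "subspace X" "X \<subseteq> Lp (real p)" "dim X = k"
    and n: "144 * \<epsilon> powr (-2) * (10 * real k / real p) powr (real p / 2) \<le> real n"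
  shows "embeds_lp X (Lp_norm (real p)) \<epsilon> (real p) n"
proof -
  obtain q where q: "p = 2 * q" using p(2) by (elim evenE)
  with p have q0: "0 < q" and k: "2 * q \<le> k" "0 < k" by auto
  have pos: "0 < 5 * real k / real q" using q0 k by simp
  \<comment> \<open>With p = 2 q the assumption p \<le> k is the one needed for counting exponents,
    and 5 k / q equals 10 k / p.\<close>
  have "144 * real (card (exponents k q)) / \<epsilon>\<^sup>2 \<le> 144 * (5 * real k / real q) ^ q / \<epsilon>\<^sup>2"
    using card_exponents_le[OF q0 k(1)] by (intro divide_right_mono mult_left_mono) auto
  also have "\<dots> = 144 * \<epsilon> powr (-2) * (10 * real k / real p) powr (real p / 2)"
  proof -
    have "\<epsilon> powr (-2) = 1 / \<epsilon>\<^sup>2" using eps by (simp add: powr_minus_divide)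
    moreover have "10 * real k / real p = 5 * real k / real q" "real p / 2 = real q"
      by (simp_all add: q)
    ultimately show ?thesis using powr_realpow[OF pos, of q] by (simp only:) simp
  qed
  finally have "144 * real (card (exponents k q)) / \<epsilon>\<^sup>2 \<le> real n" using n by linarith
  then show ?thesis
    using even_Lp_embedding[OF q0 k(2) _ _ _ eps] X by (simp add: q)
qed

text \<open>Raising the bound on 10 k / p to the power p / 2 gives (1 / 144)^(p / 2) \<epsilon>^2 n.
  As p / 2 \<ge> 1, this is at most \<epsilon>^2 n / 144, which is the first form. The constant 1440
  is 10 times 144.\<close>

lemma even_Lp_embedding_if_small_k:
  fixes p k n :: nat
  assumes p: "0 < p" "even p" "p \<le> k" and eps: "0 < \<epsilon>" "\<epsilon> < 1" and n: "0 < n"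
    and X: "subspace X" "X \<subseteq> Lp (real p)" "dim X = k"
    and k: "real k \<le> 1 / 1440 * \<epsilon> powr (4 / real p) * real p * real n powr (2 / real p)"
  shows "embeds_lp X (Lp_norm (real p)) \<epsilon> (real p) n"
proof -
  have p2: "2 \<le> p" using p by (auto elim: evenE)
  have "10 * real k / real p \<le> 1 / 144 * \<epsilon> powr (4 / real p) * real n powr (2 / real p)"
    using k p(1) by (simp add: field_simps)
  then have "(10 * real k / real p) powr (real p / 2)
      \<le> (1 / 144 * \<epsilon> powr (4 / real p) * real n powr (2 / real p)) powr (real p / 2)"
    by (intro powr_mono2) auto
  also have "\<dots> = (1 / 144) powr (real p / 2) * (\<epsilon> powr (4 / real p)) powr (real p / 2)
      * (real n powr (2 / real p)) powr (real p / 2)"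
    by (simp only: powr_mult)
  also have "\<dots> = (1 / 144) powr (real p / 2) * \<epsilon> powr 2 * real n"
    using p(1) eps n by (simp only: powr_powr) simp
  also have "\<dots> \<le> (1 / 144) powr 1 * \<epsilon> powr 2 * real n"
    using p2 by (intro mult_right_mono powr_mono') auto
  finally have "144 * \<epsilon> powr (-2) * (10 * real k / real p) powr (real p / 2)
      \<le> 144 * \<epsilon> powr (-2) * ((1 / 144) powr 1 * \<epsilon> powr 2 * real n)"
    by (intro mult_left_mono) auto
  also have "\<dots> = real n" using eps by (simp add: powr_minus)
  finally show ?thesis by (rule even_Lp_embedding_if_large_n[OF p eps X])
qed

theorem theorem2:
  "(\<exists>C::real. C > 0 \<and>
      (\<forall>(p::nat) (k::nat) (\<epsilon>::real) (X::l0 set) (n::nat).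
         p > 0 \<longrightarrow> even p \<longrightarrow> p \<le> k \<longrightarrow> 0 < \<epsilon> \<longrightarrow> \<epsilon> < 1 \<longrightarrow>
         subspace X \<longrightarrow> X \<subseteq> Lp (real p) \<longrightarrow> dim X = k \<longrightarrow>
         n > 0 \<longrightarrow> real n \<ge> C * \<epsilon> powr (-2) * (10 * real k / real p) powr (real p / 2) \<longrightarrow>
         embeds_lp X (Lp_norm (real p)) \<epsilon> (real p) n))
   \<and>
   (\<exists>c::real. c > 0 \<and>
      (\<forall>(p::nat) (\<epsilon>::real) (n::nat) (k::nat) (X::l0 set).
         p > 0 \<longrightarrow> even p \<longrightarrow> 0 < \<epsilon> \<longrightarrow> \<epsilon> < 1 \<longrightarrow> n > 0 \<longrightarrow>
         p \<le> k \<longrightarrow> real k \<le> c * \<epsilon> powr (4 / real p) * real p * real n powr (2 / real p) \<longrightarrow>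
         subspace X \<longrightarrow> X \<subseteq> Lp (real p) \<longrightarrow> dim X = k \<longrightarrow>
         embeds_lp X (Lp_norm (real p)) \<epsilon> (real p) n))"
proof (rule conjI, goal_cases)
  case 1
  show ?case
    by (rule exI[of _ 144], rule conjI, simp, intro allI impI,
        rule even_Lp_embedding_if_large_n, assumption+)
next
  case 2
  show ?case
    by (rule exI[of _ "1 / 1440"], rule conjI, simp, intro allI impI,
        rule even_Lp_embedding_if_small_k, assumption+)
qed

end
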